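(* Fix a baseline premise base $B_0$ with $m:=|B_0|$, and let $q\in\mathrm{Cn}(B_0)$ be derivable with $d:=\mathrm{Dd}(q\mid B_0)\ge1$. Let $K_q:=K(q\mid\langle B_0\rangle)$. Assume $\log m\le d\le\mathrm{poly}(m)$ and serializability. Assume moreover that $(q,B_0)$ lies in the information-rich regime, that $\mathcal P$ satisfies the richness condition with parameter $\delta_0>0$, and that $q$ is generic/incompressible at its cost scale, i.e. with $n:=N(q\mid B_0)$ one has $K_q\ge(1-\delta)n\log(m+n)$ for some $\delta>\delta_0$. Let $f_q\ge1$ be the access frequency and define $$\mathrm{Cost}^*(q;B_0):=\min\{\mathrm{Cost}_{\mathrm{cache}}(q;B_0),\ \mathrm{Cost}_{\mathrm{derive}}(q;B_0)\}.$$ Then: (i) (Asymptotic characterization) $$\mathrm{Cost}^*(q;B_0)=\min\left\{\frac{\rho K_q}{f_q}+O\!\left(\frac d{f_q}\right)+O(1),\ \Theta\!\left(\frac{K_q}{\log(m+d)}\right)\right\}.$$ (ii) (Critical frequency) The two strategies have equal asymptotic cost when $f_q=f_c$ with $f_c=\Theta(\rho\log(m+d))$. (iii) (Optimal strategy) If $f_q\gg f_c$, caching is optimal and $\mathrm{Cost}^*(q;B_0)=O(1)$. If $f_q\ll f_c$, on-demand derivation is optimal and $\mathrm{Cost}^*(q;B_0)=\mathrm{Dd}(q\mid B_0)$. If $f_q=\Theta(f_c)$, both strategies have comparable amortized cost.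
   Context: $\log=\log_2$; $\mathrm{poly}(m)$ denotes a fixed polynomial bound; asymptotics are along a family of instances $(q,B_0)$ with $m\to\infty$, with constants not depending on the instance. $\mathcal L$ is many-sorted FO(LFP) over finite structures. $\mathcal P$ is a fixed effective proof system for $\mathcal L$ with decidable proof checking and a finite rule set, each rule having at most $k$ premises ($k$ constant); $\mathrm{Cn}(\Gamma)$ is the set of formulas derivable in $\mathcal P$ from the finite set $\Gamma$. $\mathbb S_O$ is a fixed ambient set of formulas/semantic states with finite binary encodings $\mathrm{enc}_O$, decidable equality and effectively evaluable predicates. A premise base is a finite effectively listable $B\subseteq\mathbb S_O$ with decidable membership and canonical computable encoding $\langle B\rangle$. Depth: $P_O$ assigns to each $s\in\mathbb S_O$ a finite set $P_O(s)\subseteq\mathbb S_O$ computable from $\mathrm{enc}_O(s)$, and backward unfolding along $P_O$ has no infinite chain. Alignment: for $s\in\mathbb S_O\setminus B$, $P_O(s)$ is exactly the set of immediate premises in a fixed normal-form single-step inference of $\mathcal P$ concluding $s$. $\mathrm{Dd}(s\mid B)=0$ if $s\in B$, else $1+\max_{s'\in P_O(s)}\mathrm{Dd}(s'\mid B)$ (with $\max\varnothing=0$). Traces: a derivation trace of $q$ from $B$ is $\pi=((r_1,\vec p_1),\dots,(r_\ell,\vec p_\ell);o)$ with $r_i$ rule identifiers, $\vec p_i$ vectors of indices, $o$ an index, such that the following replay outputs $q$: $P_0$ is the list of elements of $B$ in canonical order; at step $i$ rule $r_i$ is applied to the formulas of the pool $P_{i-1}$ indexed by $\vec p_i$, and its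 conclusion is appended to give $P_i$; the output is the formula at index $o$ of $P_\ell$. Each rule application must be correct in $\mathcal P$. Length $|\pi|=\ell$; $N(q\mid B)$ is the minimum length of a trace deriving $q$ from $B$. $K(\cdot\mid\cdot)$ is prefix-free conditional Kolmogorov complexity with respect to a fixed universal Turing machine ($q$ identified with its encoding $\langle q\rangle$). Serializability: there are constants $c_{\min},c_{\max}>0$ such that for all $(q,B)$ in the class considered with $q\in\mathrm{Cn}(B)$ and $\mathrm{Dd}(q\mid B)<\infty$, $c_{\min}\mathrm{Dd}(q\mid B)\le N(q\mid B)\le c_{\max}\mathrm{Dd}(q\mid B)$. Information-rich regime: $K(q\mid\langle B\rangle)=\omega(\log|B|)$ along the family. Richness with parameter $\delta_0$: there is $m_0$ such that for all $m\ge m_0$, all integers $n$ with $\log m\le n\le\mathrm{poly}(m)$ and all premise bases $B$ with $|B|=m$, $|\{\langle q\rangle:N(q\mid B)=n\}|\ge2^{(1-\delta_0)n\log(m+n)}$. Cost model: storing $b$ bits costs $\rho b$ and each derivation step costs $1$, where $\rho>0$ is the relative price of storage versus computation. $\ell_q(B_0)$, the number of bits to cache $q$, is a prefix-free code length with $K_q\le\ell_q(B_0)\le K_q+O(1)$. Amortized per-access costs at frequency $f_q$ (expected number of accesses): $\mathrm{Cost}_{\mathrm{cache}}(q;B_0)=\frac{\rho\,\ell_q(B_0)}{f_q}+\frac{\mathrm{Dd}(q\mid B_0)}{f_q}+c_{\mathrm{hit}}$ with $c_{\mathrm{hit}}=O(1)$, and $\mathrm{Cost}_{\mathrm{derive}}(q;B_0)=\mathrm{Dd}(q\mid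 B_0)$.
   Formalization: δ<1 is assumed. In (iii), for f_q≫f_c caching is optimal as stated, but Cost*=O(1) is shown only if also d·f_c=O(f_q), since it fails e.g. for f_q=f_c·log d; in general Cost*=O(1+d·f_c/f_q). *)

theory Defs
  imports
    Complex_Main
    "HOL-Library.Nat_Bijection"
    "HOL-Library.Sublist"
    "HOL-Library.Landau_Symbols"
    "HOL-Computational_Algebra.Polynomial"
begin

section \<open>Syntax of many-sorted FO(LFP)\<close>

text \<open>
  Only derivability is used below, so the semantics over finite structures does not occur.
\<close>

record vocabulary =
  sorts :: "nat set"
  fun_type :: "nat \<Rightarrow> (nat list \<times> nat) option"
  rel_type :: "nat \<Rightarrow> nat list option"

definition wf_vocabulary :: "vocabulary \<Rightarrow> bool" where
  "wf_vocabulary \<Sigma> \<longleftrightarrow>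
     (\<forall>f ss s. fun_type \<Sigma> f = Some (ss, s) \<longrightarrow> set ss \<subseteq> sorts \<Sigma> \<and> s \<in> sorts \<Sigma>) \<and>
     (\<forall>R ss. rel_type \<Sigma> R = Some ss \<longrightarrow> set ss \<subseteq> sorts \<Sigma>)"

text \<open>Individual variables are pairs of a name and a sort.\<close>

datatype tm = Var nat nat | Fn nat "tm list"

datatype fm =
    Eq tm tm
  | Rel nat "tm list"
  | RVar nat "tm list"
  | Neg fm
  | Conj fm fm
  | Exi nat nat fm
  | Lfp nat "(nat \<times> nat) list" fm "tm list"

inductive tm_sort :: "vocabulary \<Rightarrow> tm \<Rightarrow> nat \<Rightarrow> bool" for \<Sigma> where
  "s \<in> sorts \<Sigma> \<Longrightarrow> tm_sort \<Sigma> (Var x s) s"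
| "fun_type \<Sigma> f = Some (ss, s) \<Longrightarrow> list_all2 (tm_sort \<Sigma>) ts ss \<Longrightarrow> tm_sort \<Sigma> (Fn f ts) s"

text \<open>
  \<open>polarity b X \<phi>\<close>: all free occurrences of the relation variable \<open>X\<close> in \<open>\<phi>\<close> are
  positive (for \<open>b = True\<close>), respectively negative (for \<open>b = False\<close>).
\<close>

fun polarity :: "bool \<Rightarrow> nat \<Rightarrow> fm \<Rightarrow> bool" where
  "polarity b X (Eq t u) = True"
| "polarity b X (Rel R ts) = True"
| "polarity b X (RVar Y ts) = (Y = X \<longrightarrow> b)"
| "polarity b X (Neg \<phi>) = polarity (\<not> b) X \<phi>"
| "polarity b X (Conj \<phi> \<psi>) = (polarity b X \<phi> \<and> polarity b X \<psi>)"
| "polarity b X (Exi x s \<phi>) = polarity b X \<phi>"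
| "polarity b X (Lfp Y xs \<phi> ts) = (Y = X \<or> polarity b X \<phi>)"

text \<open>\<open>E\<close> records the argument sorts of the relation variables in scope.\<close>

fun wf_fm :: "vocabulary \<Rightarrow> (nat \<Rightarrow> nat list option) \<Rightarrow> fm \<Rightarrow> bool" where
  "wf_fm \<Sigma> E (Eq t u) = (\<exists>s. tm_sort \<Sigma> t s \<and> tm_sort \<Sigma> u s)"
| "wf_fm \<Sigma> E (Rel R ts) = (\<exists>ss. rel_type \<Sigma> R = Some ss \<and> list_all2 (tm_sort \<Sigma>) ts ss)"
| "wf_fm \<Sigma> E (RVar X ts) = (\<exists>ss. E X = Some ss \<and> list_all2 (tm_sort \<Sigma>) ts ss)"
| "wf_fm \<Sigma> E (Neg \<phi>) = wf_fm \<Sigma> E \<phi>"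
| "wf_fm \<Sigma> E (Conj \<phi> \<psi>) = (wf_fm \<Sigma> E \<phi> \<and> wf_fm \<Sigma> E \<psi>)"
| "wf_fm \<Sigma> E (Exi x s \<phi>) = (s \<in> sorts \<Sigma> \<and> wf_fm \<Sigma> E \<phi>)"
| "wf_fm \<Sigma> E (Lfp X xs \<phi> ts) =
     (distinct xs \<and> set (map snd xs) \<subseteq> sorts \<Sigma> \<and>
      list_all2 (tm_sort \<Sigma>) ts (map snd xs) \<and>
      polarity True X \<phi> \<and> wf_fm \<Sigma> (E(X := Some (map snd xs))) \<phi>)"

definition fo_lfp :: "vocabulary \<Rightarrow> fm set" where
  "fo_lfp \<Sigma> = {\<phi>. wf_fm \<Sigma> (\<lambda>_. None) \<phi>}"


section \<open>Computability\<close>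

text \<open>Kleene's partial recursive functions.\<close>

datatype recf =
  Zero | Succ | Proj nat | Comp recf "recf list" | PrimRec recf recf | Mu recf

inductive reval :: "recf \<Rightarrow> nat list \<Rightarrow> nat \<Rightarrow> bool" where
  "reval Zero xs 0"
| "reval Succ (x # xs) (Suc x)"
| "i < length xs \<Longrightarrow> reval (Proj i) xs (xs ! i)"
| "list_all2 (\<lambda>g y. reval g xs y) gs ys \<Longrightarrow> reval f ys z \<Longrightarrow> reval (Comp f gs) xs z"
| "reval f xs y \<Longrightarrow> reval (PrimRec f g) (0 # xs) y"
| "reval (PrimRec f g) (n # xs) y \<Longrightarrow> reval g (n # y # xs) z \<Longrightarrow>
     reval (PrimRec f g) (Suc n # xs) z"
| "reval f (n # xs) 0 \<Longrightarrow> (\<forall>k<n. \<exists>y. reval f (k # xs) (Suc y)) \<Longrightarrow> reval (Mu f) xs n"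

definition decidable :: "nat set \<Rightarrow> bool" where
  "decidable A \<longleftrightarrow> (\<exists>f. \<forall>x. reval f [x] (if x \<in> A then 1 else 0))"

text \<open>The bijection between bit strings and natural numbers given by bijective base 2.\<close>

fun bit_code :: "bool list \<Rightarrow> nat" where
  "bit_code [] = 0"
| "bit_code (b # bs) = 2 * bit_code bs + (if b then 2 else 1)"


section \<open>Prefix-free conditional Kolmogorov complexity\<close>

text \<open>A machine maps a program and a conditional input to an output, or diverges.\<close>

type_synonym machine = "bool list \<Rightarrow> bool list \<Rightarrow> bool list option"

definition partial_computable :: "machine \<Rightarrow> bool" where
  "partial_computable V \<longleftrightarrow>
     (\<exists>f. \<forall>p y x. V p y = Some x \<longleftrightarrow> reval f [bit_code p, bit_code y] (bit_code x))"

definition prefix_free_machine :: "machine \<Rightarrow> bool" where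
  "prefix_free_machine V \<longleftrightarrow>
     (\<forall>y p p'. V p y \<noteq> None \<and> V p' y \<noteq> None \<and> prefix p p' \<longrightarrow> p = p')"

definition universal_machine :: "machine \<Rightarrow> bool" where
  "universal_machine U \<longleftrightarrow>
     partial_computable U \<and> prefix_free_machine U \<and>
     (\<forall>V. partial_computable V \<and> prefix_free_machine V \<longrightarrow>
        (\<exists>w. \<forall>p y. U (w @ p) y = V p y))"

text \<open>\<open>cond_K U x y\<close> is \<open>K(x | y)\<close>; the minimum exists whenever \<open>U\<close> is universal.\<close>

definition cond_K :: "machine \<Rightarrow> bool list \<Rightarrow> bool list \<Rightarrow> nat" where
  "cond_K U x y = (LEAST n. \<exists>p. length p = n \<and> U p y = Some x)"


section \<open>Proof systems and premise bases\<close>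

record 'f proof_system =
  rule_ids :: "nat set"
  conclusion :: "nat \<Rightarrow> 'f list \<Rightarrow> 'f option"

text \<open>
  \<open>conclusion P r ps = None\<close> means that rule \<open>r\<close> is not applicable to \<open>ps\<close>. The last
  conjunct is decidability of proof checking, that is, of whether \<open>\<phi>\<close> is the conclusion of
  rule \<open>r\<close> applied to \<open>ps\<close>.
\<close>

definition effective_proof_system ::
  "'f set \<Rightarrow> ('f \<Rightarrow> bool list) \<Rightarrow> nat \<Rightarrow> 'f proof_system \<Rightarrow> bool" where
  "effective_proof_system L enc k P \<longleftrightarrow>
     finite (rule_ids P) \<and>
     (\<forall>r\<in>rule_ids P. \<forall>ps \<phi>. conclusion P r ps = Some \<phi> \<longrightarrow>
        length ps \<le> k \<and> set ps \<subseteq> L \<and> \<phi> \<in> L) \<and>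
     inj_on enc L \<and>
     decidable ((\<lambda>\<phi>. bit_code (enc \<phi>)) ` L) \<and>
     decidable {list_encode [r, list_encode (map (\<lambda>p. bit_code (enc p)) ps), bit_code (enc \<phi>)]
                | r ps \<phi>. r \<in> rule_ids P \<and> conclusion P r ps = Some \<phi>}"

inductive_set Cn :: "'f proof_system \<Rightarrow> 'f set \<Rightarrow> 'f set" for P \<Gamma> where
  "\<phi> \<in> \<Gamma> \<Longrightarrow> \<phi> \<in> Cn P \<Gamma>"
| "r \<in> rule_ids P \<Longrightarrow> conclusion P r ps = Some \<phi> \<Longrightarrow> \<forall>p\<in>set ps. p \<in> Cn P \<Gamma> \<Longrightarrow> \<phi> \<in> Cn P \<Gamma>"

text \<open>
  Equality on the ambient set is decidable because the encoding is injective.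
\<close>

definition ambient_set :: "'f set \<Rightarrow> ('f \<Rightarrow> bool list) \<Rightarrow> 'f set \<Rightarrow> bool" where
  "ambient_set L enc S \<longleftrightarrow> S \<subseteq> L \<and> decidable ((\<lambda>s. bit_code (enc s)) ` S)"

text \<open>A finite set is always listable with decidable membership.\<close>

definition premise_base :: "'f set \<Rightarrow> 'f set \<Rightarrow> bool" where
  "premise_base S B \<longleftrightarrow> finite B \<and> B \<subseteq> S"

text \<open>
  \<open>ord B\<close> lists \<open>B\<close> in canonical order and \<open>encB B\<close> is the encoding of \<open>B\<close>. It is
  computable from any listing of \<open>B\<close>, and the canonical list is computable from it.
\<close>

definition canonical_encoding ::
  "('f \<Rightarrow> bool list) \<Rightarrow> 'f set \<Rightarrow> ('f set \<Rightarrow> 'f list) \<Rightarrow> ('f set \<Rightarrow> bool list) \<Rightarrow> bool" where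
  "canonical_encoding enc S ord encB \<longleftrightarrow>
     (\<forall>B. premise_base S B \<longrightarrow> distinct (ord B) \<and> set (ord B) = B) \<and>
     (\<exists>f. \<forall>B. premise_base S B \<longrightarrow>
        reval f [bit_code (encB B)] (list_encode (map (\<lambda>s. bit_code (enc s)) (ord B)))) \<and>
     (\<exists>f. \<forall>B xs. premise_base S B \<and> distinct xs \<and> set xs = B \<longrightarrow>
        reval f [list_encode (map (\<lambda>s. bit_code (enc s)) xs)] (bit_code (encB B)))"


section \<open>Derivation depth\<close>

definition predecessor_map ::
  "('f \<Rightarrow> bool list) \<Rightarrow> 'f set \<Rightarrow> ('f \<Rightarrow> 'f set) \<Rightarrow> bool" where
  "predecessor_map enc S PO \<longleftrightarrow>
     (\<forall>s\<in>S. finite (PO s) \<and> PO s \<subseteq> S) \<and>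
     (\<exists>f. \<forall>s\<in>S. \<exists>xs. set xs = PO s \<and>
        reval f [bit_code (enc s)] (list_encode (map (\<lambda>t. bit_code (enc t)) xs))) \<and>
     wf {(t, s). s \<in> S \<and> t \<in> PO s}"

text \<open>\<open>nf s\<close> is the fixed normal-form inference concluding \<open>s\<close>: a rule and its premises.\<close>

definition aligned ::
  "'f proof_system \<Rightarrow> 'f set \<Rightarrow> ('f \<Rightarrow> 'f set) \<Rightarrow> ('f \<Rightarrow> nat \<times> 'f list) \<Rightarrow> 'f set \<Rightarrow> bool" where
  "aligned P S PO nf B \<longleftrightarrow>
     (\<forall>s\<in>S - B. fst (nf s) \<in> rule_ids P \<and>
        conclusion P (fst (nf s)) (snd (nf s)) = Some s \<and> PO s = set (snd (nf s)))"

text \<open>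
  Inserting 0 only serves to make the maximum of the empty set 0. If \<open>PO\<close> is a predecessor
  map, the recursion is well-founded and finitely branching, so the depth of every element
  of \<open>S\<close> is finite.
\<close>

definition Dd :: "'f set \<Rightarrow> ('f \<Rightarrow> 'f set) \<Rightarrow> 'f set \<Rightarrow> 'f \<Rightarrow> nat" where
  "Dd S PO B = wfrec {(t, s). s \<in> S \<and> t \<in> PO s}
     (\<lambda>D s. if s \<in> B then 0 else 1 + Max (insert 0 (D ` PO s)))"


section \<open>Derivation traces\<close>

fun replay :: "'f proof_system \<Rightarrow> 'f list \<Rightarrow> (nat \<times> nat list) list \<Rightarrow> 'f list option" where
  "replay P pool [] = Some pool"
| "replay P pool ((r, js) # \<pi>) =
     (if r \<in> rule_ids P \<and> (\<forall>j\<in>set js. j < length pool) then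
        (case conclusion P r (map (\<lambda>j. pool ! j) js) of
           None \<Rightarrow> None
         | Some \<phi> \<Rightarrow> replay P (pool @ [\<phi>]) \<pi>)
      else None)"

definition derives_by ::
  "'f proof_system \<Rightarrow> 'f list \<Rightarrow> (nat \<times> nat list) list \<times> nat \<Rightarrow> 'f \<Rightarrow> bool" where
  "derives_by P base tr q \<longleftrightarrow>
     (\<exists>pool. replay P base (fst tr) = Some pool \<and> snd tr < length pool \<and> pool ! (snd tr) = q)"

text \<open>\<open>N(q | B)\<close>; meaningful only if \<open>q\<close> is derivable from \<open>B\<close>.\<close>

definition min_trace_length ::
  "'f proof_system \<Rightarrow> ('f set \<Rightarrow> 'f list) \<Rightarrow> 'f set \<Rightarrow> 'f \<Rightarrow> nat" where
  "min_trace_length P ord B q = (LEAST l. \<exists>tr. derives_by P (ord B) tr q \<and> length (fst tr) = l)"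

text \<open>\<open>\<C>\<close> is the class of pairs considered. The depth is a natural number, hence finite.\<close>

definition serializable ::
  "'f proof_system \<Rightarrow> ('f set \<Rightarrow> 'f list) \<Rightarrow> 'f set \<Rightarrow> ('f \<Rightarrow> 'f set) \<Rightarrow> ('f \<times> 'f set) set \<Rightarrow> bool"
where
  "serializable P ord S PO \<C> \<longleftrightarrow>
     (\<exists>cmin cmax :: real. cmin > 0 \<and> cmax > 0 \<and>
       (\<forall>(q, B)\<in>\<C>. q \<in> Cn P B \<longrightarrow>
          cmin * real (Dd S PO B q) \<le> real (min_trace_length P ord B q) \<and>
          real (min_trace_length P ord B q) \<le> cmax * real (Dd S PO B q)))"

definition rich ::
  "'f proof_system \<Rightarrow> ('f \<Rightarrow> bool list) \<Rightarrow> ('f set \<Rightarrow> 'f list) \<Rightarrow> 'f set \<Rightarrow> real poly \<Rightarrow> real \<Rightarrow> bool"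
where
  "rich P enc ord S bnd \<delta>\<^sub>0 \<longleftrightarrow>
     (\<exists>m\<^sub>0::nat. \<forall>m\<ge>m\<^sub>0. \<forall>n::nat. log 2 (real m) \<le> real n \<and> real n \<le> poly bnd (real m) \<longrightarrow>
       (\<forall>B. premise_base S B \<and> card B = m \<longrightarrow>
          real (card {enc q | q. q \<in> Cn P B \<and> min_trace_length P ord B q = n})
            \<ge> 2 powr ((1 - \<delta>\<^sub>0) * real n * log 2 (real (m + n)))))"


section \<open>Cost model\<close>

text \<open>
  \<open>cw B q\<close> is the code word under which \<open>q\<close> is cached relative to \<open>B\<close>; for each \<open>B\<close> these
  form a prefix-free code, whose lengths exceed \<open>K(q | \<langle>B\<rangle>)\<close> by at most a constant.
\<close>

definition cache_code ::
  "machine \<Rightarrow> 'f proof_system \<Rightarrow> ('f \<Rightarrow> bool list) \<Rightarrow> 'f set \<Rightarrow> ('f set \<Rightarrow> bool list) \<Rightarrow>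
   ('f set \<Rightarrow> 'f \<Rightarrow> bool list) \<Rightarrow> bool" where
  "cache_code U P enc S encB cw \<longleftrightarrow>
     (\<forall>B. premise_base S B \<longrightarrow>
        (\<forall>x\<in>Cn P B. \<forall>y\<in>Cn P B. prefix (cw B x) (cw B y) \<longrightarrow> x = y)) \<and>
     (\<exists>C::nat. \<forall>B q. premise_base S B \<and> q \<in> Cn P B \<longrightarrow>
        cond_K U (enc q) (encB B) \<le> length (cw B q) \<and>
        length (cw B q) \<le> cond_K U (enc q) (encB B) + C)"

definition cost_cache :: "real \<Rightarrow> real \<Rightarrow> real \<Rightarrow> real \<Rightarrow> real \<Rightarrow> real" where
  "cost_cache \<rho> l d c_hit f = \<rho> * l / f + d / f + c_hit"

definition cost_deriv :: "real \<Rightarrow> real" where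
  "cost_deriv d = d"

definition cost_opt :: "real \<Rightarrow> real \<Rightarrow> real \<Rightarrow> real \<Rightarrow> real \<Rightarrow> real" where
  "cost_opt \<rho> l d c_hit f = min (cost_cache \<rho> l d c_hit f) (cost_deriv d)"

end

(* Idea: everything rests on K_q being of the exact order d log(m+d). The lower bound is genericity
   combined with serializability. For the upper bound, a minimal trace consists of n steps, each
   picking one of finitely many rules and at most k of the at most m+n formulas of the pool, so it
   has a self-delimiting description of O(n log(m+n)) bits; a machine that decodes the description
   and replays the trace on the base is prefix-free, and the universal machine simulates it. With
   f_c = 1 + \<rho> l / d, caching costs exactly d f_c / f + c_hit, and since d tends to infinity while
   c_hit stays bounded, comparing this with d is comparing f with f_c. *)

theory Submission
  imports Defs
begin

section \<open>Computable functions\<close>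

text \<open>The obstacle in the upper bound is that machines are Kleene functions, while
  \<open>conclusion\<close> comes with a decision procedure for checking a step and not with an
  algorithm computing its result. The decoder therefore does not execute a trace: it searches for a
  number coding the whole final pool and accepts when every step passes the check. A pool other than
  the true one may be found, but injectivity of the encoding forces all accepted pools to agree on
  the entries that matter. Acceptance includes the self-delimiting shape of the program, so
  prefix-freeness holds for every conditional input, also for those encoding no base. The acceptance
  test has to be shown recursive, which is why arithmetic, pairing and list access are rebuilt from
  the recursion schemes. Constant factors lost in coding disappear in the \<Theta>, and the additive
  overhead of the cache code is of lower order because d log(m+d) tends to infinity.\<close>

inductive_cases reval_ZeroE: "reval Zero xs y"
inductive_cases reval_SuccE: "reval Succ xs y"
inductive_cases reval_ProjE: "reval (Proj i) xs y"
inductive_cases reval_CompE: "reval (Comp f gs) xs y"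
inductive_cases reval_PrimRec0E: "reval (PrimRec f g) (0 # xs) y"
inductive_cases reval_PrimRecSucE: "reval (PrimRec f g) (Suc n # xs) y"
inductive_cases reval_MuE: "reval (Mu f) xs y"

text \<open>This allows \<open>reval\<close> to be read as a partial function, both when a halting
  search is inverted and when a machine is defined by a definite description.\<close>

lemma reval_functional: "reval f xs y \<Longrightarrow> reval f xs z \<Longrightarrow> z = y"
proof (induction arbitrary: z rule: reval.induct)
  case (4 xs gs ys f y)
  from "4.prems" obtain zs where zs: "list_all2 (\<lambda>g y. reval g xs y) gs zs" "reval f zs z"
    by (rule reval_CompE)
  have "zs = ys"
    using "4.IH"(1) zs(1) by (auto simp: list_all2_conv_all_nth intro!: nth_equalityI)
  with "4.IH"(2) zs(2) show ?case by blast
next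
  case (5 f xs y g)
  then show ?case by (blast elim: reval_PrimRec0E)
next
  case (6 f g n xs y z')
  then show ?case by (blast elim: reval_PrimRecSucE)
next
  case (7 f n xs)
  from "7.prems" have z: "reval f (z # xs) 0" "\<forall>k<z. \<exists>y. reval f (k # xs) (Suc y)"
    by (blast elim: reval_MuE)+
  have "\<not> z < n"
    using "7.IH"(2) z(1) by (metis nat.distinct(1))
  moreover have "\<not> n < z"
    using "7.IH"(1) z(2) by (metis nat.distinct(1))
  ultimately show ?case by simp
qed (auto elim: reval_ZeroE reval_SuccE reval_ProjE)

text \<open>Total functions of fixed arity \<open>a\<close>; lists of other lengths are left open,
  so that arguments can be written as \<open>xs ! i\<close>.\<close>

definition computable :: "nat \<Rightarrow> (nat list \<Rightarrow> nat) \<Rightarrow> bool" where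
  "computable a F \<longleftrightarrow> (\<exists>f. \<forall>xs. length xs = a \<longrightarrow> reval f xs (F xs))"

lemma computable_Comp:
  assumes "computable (length Gs) F" "\<forall>G\<in>set Gs. computable a G"
  shows "computable a (\<lambda>xs. F (map (\<lambda>G. G xs) Gs))"
proof -
  obtain f where f: "\<And>ys. length ys = length Gs \<Longrightarrow> reval f ys (F ys)"
    using assms(1) by (auto simp: computable_def)
  obtain h where h: "\<And>G xs. G \<in> set Gs \<Longrightarrow> length xs = a \<Longrightarrow> reval (h G) xs (G xs)"
    using assms(2) unfolding computable_def by metis
  have "reval (Comp f (map h Gs)) xs (F (map (\<lambda>G. G xs) Gs))" if "length xs = a" for xs
    using that by (intro reval.intros(4)[where ys = "map (\<lambda>G. G xs) Gs"])
      (auto simp: list_all2_conv_all_nth intro!: h f)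
  then show ?thesis unfolding computable_def by blast
qed

lemma computable_comp1:
  assumes "computable 1 (\<lambda>xs. g (xs ! 0))" "computable a F"
  shows "computable a (\<lambda>xs. g (F xs))"
  using computable_Comp[of "[F]" "\<lambda>xs. g (xs ! 0)" a] assms by simp

lemma computable_comp2:
  assumes "computable 2 (\<lambda>xs. g (xs ! 0) (xs ! 1))" "computable a F" "computable a G"
  shows "computable a (\<lambda>xs. g (F xs) (G xs))"
  using computable_Comp[of "[F, G]" "\<lambda>xs. g (xs ! 0) (xs ! 1)" a] assms by (simp add: numeral_2_eq_2)

lemma computable_nth: "i < a \<Longrightarrow> computable a (\<lambda>xs. xs ! i)"
  unfolding computable_def by (auto intro: reval.intros)

lemma computable_Suc:
  assumes "computable a F"
  shows "computable a (\<lambda>xs. Suc (F xs))"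
proof (rule computable_comp1[OF _ assms])
  have "reval Succ xs (Suc (xs ! 0))" if "length xs = 1" for xs
    using that reval.intros(2)[of "xs ! 0" "tl xs"] by (cases xs) auto
  then show "computable 1 (\<lambda>xs. Suc (xs ! 0))" unfolding computable_def by blast
qed

lemma computable_const: "computable a (\<lambda>_. c)"
proof (induction c)
  case 0
  show ?case unfolding computable_def by (auto intro: reval.intros)
next
  case (Suc c)
  then show ?case by (rule computable_Suc)
qed

lemma reval_PrimRec_rec_nat:
  assumes "reval f xs y" "\<And>n y. reval g (n # y # xs) (G n y)"
  shows "reval (PrimRec f g) (n # xs) (rec_nat y G n)"
proof (induction n)
  case (Suc n)
  from reval.intros(6)[OF this assms(2)] show ?case by simp
qed (use assms(1) in \<open>auto intro: reval.intros\<close>)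

lemma computable_rec_nat:
  assumes "computable 2 (\<lambda>xs. G (xs ! 0) (xs ! 1))" "computable a N"
  shows "computable a (\<lambda>xs. rec_nat c G (N xs))"
proof (rule computable_comp1[OF _ assms(2)])
  obtain f where f: "\<And>xs. length xs = 0 \<Longrightarrow> reval f xs c"
    using computable_const[of 0 c] by (auto simp: computable_def)
  obtain g where g: "\<And>xs. length xs = 2 \<Longrightarrow> reval g xs (G (xs ! 0) (xs ! 1))"
    using assms(1) by (auto simp: computable_def)
  have "reval (PrimRec f g) [n] (rec_nat c G n)" for n
    by (rule reval_PrimRec_rec_nat) (use f g[of "[_, _]"] in auto)
  then show "computable 1 (\<lambda>xs. rec_nat c G (xs ! 0))"
    unfolding computable_def by (intro exI[of _ "PrimRec f g"]) (auto simp: length_Suc_conv)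
qed

text \<open>A single parameter is enough, since several can be packed into one number by
  \<open>prod_encode\<close>.\<close>

lemma computable_rec_nat_param:
  assumes "computable 1 (\<lambda>xs. H (xs ! 0))" "computable 3 (\<lambda>xs. G (xs ! 0) (xs ! 1) (xs ! 2))"
    "computable a N" "computable a X"
  shows "computable a (\<lambda>xs. rec_nat (H (X xs)) (\<lambda>n y. G n y (X xs)) (N xs))"
proof (rule computable_comp2[OF _ assms(3,4)])
  obtain f where f: "\<And>xs. length xs = 1 \<Longrightarrow> reval f xs (H (xs ! 0))"
    using assms(1) by (auto simp: computable_def)
  obtain g where g: "\<And>xs. length xs = 3 \<Longrightarrow> reval g xs (G (xs ! 0) (xs ! 1) (xs ! 2))"
    using assms(2) by (auto simp: computable_def)
  have "reval (PrimRec f g) [n, x] (rec_nat (H x) (\<lambda>n y. G n y x) n)" for n x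
    by (rule reval_PrimRec_rec_nat) (use f[of "[_]"] g[of "[_, _, _]"] in auto)
  then show "computable 2 (\<lambda>xs. rec_nat (H (xs ! 1)) (\<lambda>n y. G n y (xs ! 1)) (xs ! 0))"
    unfolding computable_def
    by (intro exI[of _ "PrimRec f g"]) (auto simp: length_Suc_conv numeral_2_eq_2)
qed

named_theorems computable_intros

lemmas [computable_intros] = computable_nth computable_Suc computable_const

section \<open>Recursive arithmetic and bounded predicates\<close>

lemma computable_add [computable_intros]:
  assumes "computable a F" "computable a G"
  shows "computable a (\<lambda>xs. F xs + G xs)"
proof -
  have eq: "x + y = rec_nat y (\<lambda>_. Suc) x" for x y :: nat
    by (induction x) auto
  show ?thesis unfolding eq
    by (rule computable_rec_nat_param[where H = "\<lambda>y. y" and G = "\<lambda>_ z _. Suc z"])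
      (auto intro!: computable_intros assms)
qed

lemma computable_pred: "computable a F \<Longrightarrow> computable a (\<lambda>xs. F xs - 1)"
proof -
  have eq: "x - 1 = rec_nat 0 (\<lambda>n _. n) x" for x :: nat
    by (cases x) auto
  show "computable a F \<Longrightarrow> ?thesis" unfolding eq
    by (rule computable_rec_nat) (auto intro!: computable_intros)
qed

lemma computable_diff [computable_intros]:
  assumes "computable a F" "computable a G"
  shows "computable a (\<lambda>xs. F xs - G xs)"
proof -
  have eq: "rec_nat x (\<lambda>_ z. z - 1) y = x - y" for x y :: nat
    by (induction y) auto
  have "computable a (\<lambda>xs. rec_nat (F xs) (\<lambda>_ z. z - 1) (G xs))"
    by (rule computable_rec_nat_param[where H = "\<lambda>y. y" and G = "\<lambda>_ z _. z - 1"])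
      (auto intro!: computable_intros computable_pred[simplified] assms)
  then show ?thesis unfolding eq .
qed

lemma computable_mult [computable_intros]:
  assumes "computable a F" "computable a G"
  shows "computable a (\<lambda>xs. F xs * G xs)"
proof -
  have eq: "x * y = rec_nat 0 (\<lambda>_ z. z + y) x" for x y :: nat
    by (induction x) auto
  show ?thesis unfolding eq
    by (rule computable_rec_nat_param[where H = "\<lambda>_. 0" and G = "\<lambda>_ z y. z + y"])
      (auto intro!: computable_intros assms)
qed

lemma computable_power [computable_intros]:
  assumes "computable a F" "computable a G"
  shows "computable a (\<lambda>xs. F xs ^ G xs)"
proof -
  have eq: "x ^ y = rec_nat 1 (\<lambda>_ z. x * z) y" for x y :: nat
    by (induction y) auto
  show ?thesis unfolding eq
    by (rule computable_rec_nat_param[where H = "\<lambda>_. 1" and G = "\<lambda>_ z y. y * z"])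
      (auto intro!: computable_intros assms)
qed

lemma computable_if_zero [computable_intros]:
  assumes "computable a N" "computable a F" "computable a G"
  shows "computable a (\<lambda>xs. if N xs = 0 then F xs else G xs)"
proof -
  \<comment> \<open>With truncated subtraction, 1 - n is the indicator of n = 0.\<close>
  have eq: "(if n = 0 then x else y) = x * (1 - n) + y * (1 - (1 - n))" for n x y :: nat
    by (cases n) auto
  show ?thesis unfolding eq by (intro computable_intros assms)
qed

lemma computable_of_bool_le [computable_intros]:
  assumes "computable a F" "computable a G"
  shows "computable a (\<lambda>xs. of_bool (F xs \<le> G xs))"
proof -
  have eq: "(of_bool (x \<le> y) :: nat) = 1 - (x - y)" for x y :: nat by auto
  show ?thesis unfolding eq by (intro computable_intros assms)
qed

lemma computable_of_bool_less [computable_intros]: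
  assumes "computable a F" "computable a G"
  shows "computable a (\<lambda>xs. of_bool (F xs < G xs))"
  unfolding less_eq_Suc_le by (intro computable_intros assms)

lemma computable_of_bool_conj [computable_intros]:
  assumes "computable a (\<lambda>xs. of_bool (Q xs))" "computable a (\<lambda>xs. of_bool (R xs))"
  shows "computable a (\<lambda>xs. of_bool (Q xs \<and> R xs))"
  unfolding of_bool_conj by (intro computable_intros assms)

lemma computable_of_bool_eq [computable_intros]:
  assumes "computable a F" "computable a G"
  shows "computable a (\<lambda>xs. of_bool (F xs = G xs))"
  unfolding order_eq_iff by (intro computable_intros assms)

lemma computable_of_bool_all_less:
  assumes "computable 2 (\<lambda>xs. of_bool (R (xs ! 0) (xs ! 1)))" "computable a N" "computable a X"
  shows "computable a (\<lambda>xs. of_bool (\<forall>j<N xs. R j (X xs)))"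
proof -
  have eq: "(of_bool (\<forall>j<n. R j x) :: nat) = rec_nat 1 (\<lambda>j z. z * of_bool (R j x)) n" for n x
  proof (induction n)
    case (Suc n)
    have "(\<forall>j<Suc n. R j x) \<longleftrightarrow> (\<forall>j<n. R j x) \<and> R n x" by (auto simp: less_Suc_eq)
    with Suc show ?case by (simp only: of_bool_conj old.nat.simps)
  qed simp
  show ?thesis unfolding eq
    by (rule computable_rec_nat_param[where H = "\<lambda>_. 1" and G = "\<lambda>j z x. z * of_bool (R j x)"])
      (auto intro!: computable_intros computable_comp2[OF assms(1)] assms(2,3))
qed

lemma decidable_imp_computable:
  assumes "decidable A" "computable a F"
  shows "computable a (\<lambda>xs. of_bool (F xs \<in> A))"
proof (rule computable_comp1[OF _ assms(2)])
  obtain f where f: "\<And>x. reval f [x] (if x \<in> A then 1 else 0)"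
    using assms(1) by (auto simp: decidable_def)
  have "reval f xs (of_bool (xs ! 0 \<in> A))" if "length xs = 1" for xs
    using that f[of "xs ! 0"] by (cases xs) (auto split: if_splits)
  then show "computable 1 (\<lambda>xs. of_bool (xs ! 0 \<in> A))" unfolding computable_def by blast
qed

text \<open>Bounded search: the recursion keeps the last index at which \<open>Q\<close> held, so
  after n rounds its value is min n (g x). It serves to invert a monotone function, namely
  \<open>triangle\<close> for unpairing and multiplication for division.\<close>

lemma computable_greatest:
  assumes Q: "computable 2 (\<lambda>xs. of_bool (Q (xs ! 0) (xs ! 1)))"
    and g: "\<And>i x. Q (Suc i) x \<longleftrightarrow> Suc i \<le> g x" and bound: "\<And>x. g x \<le> h x"
    and h: "computable 1 (\<lambda>xs. h (xs ! 0))" and X: "computable a X"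
  shows "computable a (\<lambda>xs. g (X xs))"
proof -
  let ?G = "\<lambda>i z x. if 1 - of_bool (Q (Suc i) x) = (0::nat) then Suc i else z"
  have "rec_nat 0 (\<lambda>i z. ?G i z x) n = min n (g x)" for n x
    by (induction n) (auto simp: g min_def not_less_eq_eq)
  then have eq: "g x = rec_nat 0 (\<lambda>i z. ?G i z x) (h x)" for x
    using bound[of x] by (simp add: min_absorb2)
  show ?thesis unfolding eq
    by (rule computable_rec_nat_param[where H = "\<lambda>_. 0" and G = ?G])
      (intro computable_intros computable_comp2[OF Q] computable_comp1[OF h] X; simp)+
qed

section \<open>Cantor pairing and its projections\<close>

definition pfst :: "nat \<Rightarrow> nat" where "pfst x = fst (prod_decode x)"
definition psnd :: "nat \<Rightarrow> nat" where "psnd x = snd (prod_decode x)"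

lemma pfst_prod_encode [simp]: "pfst (prod_encode (x, y)) = x"
  and psnd_prod_encode [simp]: "psnd (prod_encode (x, y)) = y"
  by (simp_all add: pfst_def psnd_def)

lemma prod_encode_pfst_psnd [simp]: "prod_encode (pfst x, psnd x) = x"
  by (simp add: pfst_def psnd_def)

lemma computable_triangle [computable_intros]:
  assumes "computable a F"
  shows "computable a (\<lambda>xs. triangle (F xs))"
proof -
  have eq: "triangle n = rec_nat 0 (\<lambda>i z. z + Suc i) n" for n
    by (induction n) (auto simp: triangle_Suc)
  show ?thesis unfolding eq
    by (rule computable_rec_nat) (auto intro!: computable_intros assms)
qed

lemma computable_prod_encode [computable_intros]:
  assumes "computable a F" "computable a G"
  shows "computable a (\<lambda>xs. prod_encode (F xs, G xs))"
  unfolding prod_encode_def by (simp, intro computable_intros assms)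

lemma triangle_mono: "i \<le> j \<Longrightarrow> triangle i \<le> triangle j"
  by (induction rule: dec_induct) (auto simp: triangle_Suc)

lemma triangle_le_iff: "triangle i \<le> x \<longleftrightarrow> i \<le> pfst x + psnd x"
proof -
  have x: "x = triangle (pfst x + psnd x) + pfst x"
    using prod_encode_pfst_psnd[of x] by (simp add: prod_encode_def)
  show ?thesis
  proof
    assume "i \<le> pfst x + psnd x"
    from triangle_mono[OF this] show "triangle i \<le> x" by (subst x) simp
  next
    assume i: "triangle i \<le> x"
    show "i \<le> pfst x + psnd x"
    proof (rule ccontr)
      assume "\<not> ?thesis"
      then have "Suc (pfst x + psnd x) \<le> i" by simp
      from triangle_mono[OF this] i x show False by simp
    qed
  qed
qed

text \<open>The sum of the components is the number of the diagonal on which the pair lies, hence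
  the greatest i with triangle i \<le> x. The components are then obtained from it by
  subtraction.\<close>

lemma computable_pfst_add_psnd:
  assumes "computable a F"
  shows "computable a (\<lambda>xs. pfst (F xs) + psnd (F xs))"
proof (rule computable_greatest[where Q = "\<lambda>i x. triangle i \<le> x" and h = "\<lambda>x. x"
      and g = "\<lambda>x. pfst x + psnd x" and X = F])
  show "pfst x + psnd x \<le> x" for x
  proof -
    have "x = triangle (pfst x + psnd x) + pfst x"
      using prod_encode_pfst_psnd[of x] by (simp add: prod_encode_def)
    moreover have "j \<le> triangle j" for j by (induction j) auto
    from this[of "pfst x + psnd x"] have "pfst x + psnd x \<le> triangle (pfst x + psnd x)" .
    ultimately show ?thesis by linarith
  qed
  show "computable 2 (\<lambda>xs. of_bool (triangle (xs ! 0) \<le> xs ! 1))"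
    by (intro computable_intros; simp)
qed (simp_all only: triangle_le_iff computable_nth assms less_one)

lemma computable_pfst [computable_intros]:
  assumes "computable a F"
  shows "computable a (\<lambda>xs. pfst (F xs))"
proof -
  have eq: "x - triangle (pfst x + psnd x) = pfst x" for x
    using prod_encode_pfst_psnd[of x] by (simp add: prod_encode_def)
  have "computable a (\<lambda>xs. F xs - triangle (pfst (F xs) + psnd (F xs)))"
    by (intro computable_diff computable_triangle computable_pfst_add_psnd assms)
  then show ?thesis unfolding eq .
qed

lemma computable_psnd [computable_intros]:
  assumes "computable a F"
  shows "computable a (\<lambda>xs. psnd (F xs))"
proof -
  have "computable a (\<lambda>xs. (pfst (F xs) + psnd (F xs)) - pfst (F xs))"
    by (intro computable_diff computable_pfst computable_pfst_add_psnd assms)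
  then show ?thesis by simp
qed

lemma computable_div [computable_intros]:
  assumes "computable a F" "computable a G"
  shows "computable a (\<lambda>xs. F xs div G xs)"
proof -
  \<comment> \<open>The conjunct \<open>0 < y\<close> makes the search return 0 for a zero divisor,
    in agreement with \<open>div\<close>.\<close>
  have "Suc i * y \<le> x \<and> 0 < y \<longleftrightarrow> Suc i \<le> x div y" for i x y :: nat
    by (cases "y = 0") (simp_all add: less_eq_div_iff_mult_less_eq del: mult_Suc)
  moreover have "computable 2
      (\<lambda>xs. of_bool (xs ! 0 * psnd (xs ! 1) \<le> pfst (xs ! 1) \<and> 0 < psnd (xs ! 1)))"
    by (intro computable_intros; simp)
  moreover have "computable 1 (\<lambda>xs. pfst (xs ! 0))" "computable a (\<lambda>xs. prod_encode (F xs, G xs))"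
    by (intro computable_intros assms; simp)+
  ultimately have "computable a (\<lambda>xs. (\<lambda>x. pfst x div psnd x) (prod_encode (F xs, G xs)))"
    by (intro computable_greatest[where Q = "\<lambda>i x. i * psnd x \<le> pfst x \<and> 0 < psnd x" and h = pfst
          and g = "\<lambda>x. pfst x div psnd x" and X = "\<lambda>xs. prod_encode (F xs, G xs)"]) (simp_all only: div_le_dividend)
  then show ?thesis by simp
qed

lemma computable_mod [computable_intros]:
  assumes "computable a F" "computable a G"
  shows "computable a (\<lambda>xs. F xs mod G xs)"
  unfolding modulo_nat_def by (intro computable_intros assms)

section \<open>Access to codes of lists\<close>

text \<open>Junk values at 0, the code of the empty list.\<close>

definition code_tl :: "nat \<Rightarrow> nat" where "code_tl x = psnd (x - 1)"

definition code_nth :: "nat \<Rightarrow> nat \<Rightarrow> nat" where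
  "code_nth x i = pfst (rec_nat x (\<lambda>_. code_tl) i - 1)"

lemma code_tl_Cons [simp]: "code_tl (list_encode (x # xs)) = list_encode xs"
  by (simp add: code_tl_def)

lemma rec_nat_code_tl:
  "i \<le> length xs \<Longrightarrow> rec_nat (list_encode xs) (\<lambda>_. code_tl) i = list_encode (drop i xs)"
proof (induction i)
  case (Suc i)
  then show ?case
    by (simp add: Cons_nth_drop_Suc[of i xs, symmetric] del: list_encode.simps)
qed simp

lemma code_nth_list_encode [simp]: "i < length xs \<Longrightarrow> code_nth (list_encode xs) i = xs ! i"
  using Cons_nth_drop_Suc[of i xs, symmetric] by (simp add: code_nth_def rec_nat_code_tl)

lemma code_nth_0_Cons [simp]: "code_nth (Suc (prod_encode (x, y))) 0 = x"
  and code_tl_Suc [simp]: "code_tl (Suc (prod_encode (x, y))) = y"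
  by (simp_all add: code_nth_def code_tl_def)

lemma computable_code_tl [computable_intros]:
  "computable a F \<Longrightarrow> computable a (\<lambda>xs. code_tl (F xs))"
  unfolding code_tl_def by (intro computable_intros)

lemma computable_code_nth [computable_intros]:
  assumes "computable a F" "computable a G"
  shows "computable a (\<lambda>xs. code_nth (F xs) (G xs))"
  unfolding code_nth_def
  by (intro computable_intros computable_rec_nat_param[where H = "\<lambda>y. y" and G = "\<lambda>_ z _. code_tl z"] assms; simp)

section \<open>A prefix-free machine replaying traces\<close>

lemma bit_code_append: "bit_code (p @ r) = bit_code p + 2 ^ length p * bit_code r"
  by (induction p) (auto simp: algebra_simps)

text \<open>Strings of length n occupy exactly the codes from 2^n - 1 to 2^(n+1) - 2, so a code
  determines the length.\<close>

lemma bit_code_bounds: "2 ^ length p \<le> bit_code p + 1" "bit_code p + 1 < 2 * 2 ^ length p"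
  by (induction p) auto

lemma bit_code_inject: "bit_code p = bit_code p' \<longleftrightarrow> p = p'"
proof
  show "bit_code p = bit_code p' \<Longrightarrow> p = p'"
  proof (induction p arbitrary: p')
    case Nil
    then show ?case by (cases p') (auto split: if_splits)
  next
    case (Cons b bs)
    then obtain b' bs' where p': "p' = b' # bs'"
      by (cases p') (auto split: if_splits)
    have "(b \<longleftrightarrow> b') \<and> bit_code bs = bit_code bs'"
      using Cons.prems unfolding p' by (cases b; cases b'; simp; presburger)
    with Cons.IH p' show ?case by simp
  qed
qed simp

lemma bit_code_surj: "\<exists>p. bit_code p = n"
proof (induction n rule: less_induct)
  case (less n)
  show ?case
  proof (cases "n = 0")
    case False
    then have "(n - 1) div 2 < n" by linarith
    from less[OF this] obtain p where p: "bit_code p = (n - 1) div 2" by blast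
    have "bit_code (even n # p) = n" using False p by (cases "even n") (auto elim!: evenE oddE)
    then show ?thesis ..
  qed (auto intro: exI[of _ "[]"])
qed

section \<open>Self-delimiting programs\<close>

text \<open>The codes of the strings \<open>1\<^sup>a 0 w\<close> with \<open>w\<close> of length \<open>a\<close> and code \<open>W\<close>.\<close>

definition self_delimiting :: "nat \<Rightarrow> nat \<Rightarrow> nat \<Rightarrow> bool" where
  "self_delimiting c a W \<longleftrightarrow> c + 2 = 2 ^ a * (2 * W + 3) \<and> 2 ^ a \<le> W + 1 \<and> W + 1 < 2 * 2 ^ a"

text \<open>In the code c of a leading ones, a zero and a string w, the ones contribute 2^(a+1) - 2
  and the zero 2^a. Hence c + 2 is 2^a times an odd number, and uniqueness of this factorization
  decodes both a and w.\<close>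

lemma power2_mult_odd_unique:
  fixes x y :: nat
  assumes "2 ^ a * (2 * x + 1) = 2 ^ b * (2 * y + 1)"
  shows "a = b \<and> x = y"
proof -
  have *: "\<not> a < b" if eq: "2 ^ a * (2 * x + 1) = 2 ^ b * (2 * y + 1)" for a b x y :: nat
  proof
    assume "a < b"
    then obtain c where "b = a + Suc c" using less_iff_Suc_add by auto
    with eq have "2 ^ a * (2 * x + 1) = 2 ^ a * (2 * (2 ^ c * (2 * y + 1)))"
      by (simp only: power_add power_Suc mult_ac)
    then have "2 * x + 1 = 2 * (2 ^ c * (2 * y + 1))"
      unfolding mult_cancel1 by simp
    then show False by presburger
  qed
  have "a = b" using *[OF assms] *[OF assms[symmetric]] by simp
  with assms show ?thesis by simp
qed

lemma self_delimiting_unique: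
  assumes "self_delimiting c a W" "self_delimiting c a' W'"
  shows "W' = W"
proof -
  have "2 * (x + 1) + 1 = 2 * x + 3" for x :: nat by simp
  then have "2 ^ a * (2 * (W + 1) + 1) = 2 ^ a' * (2 * (W' + 1) + 1)"
    using assms unfolding self_delimiting_def by metis
  from power2_mult_odd_unique[OF this] show ?thesis by simp
qed

text \<open>The bounds on \<open>W\<close> place \<open>bit_code p + 1\<close> between 2^(2a+1) and
  2^(2a+2), an interval belonging to a single length.\<close>

lemma length_self_delimiting:
  assumes "self_delimiting (bit_code p) a W"
  shows "length p = 2 * a + 1"
proof -
  define A :: nat where "A = 2 ^ a"
  have c: "bit_code p + 2 = A * (2 * W + 3)" and W: "A \<le> W + 1" "W + 1 < 2 * A" and A: "A \<ge> 1"
    using assms by (auto simp: self_delimiting_def A_def)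
  have pow: "2 ^ (2 * a + 1) = 2 * (A * A)" "2 ^ (2 * a + 2) = 4 * (A * A)"
    by (simp_all add: A_def power_add mult_2)
  have "A * (2 * A + 1) \<le> A * (2 * W + 3)" using W by (intro mult_left_mono) auto
  then have "2 * (A * A) + A \<le> bit_code p + 2"
    unfolding c by (simp add: distrib_left)
  with A have lo: "2 ^ (2 * a + 1) \<le> bit_code p + 1"
    unfolding pow by linarith
  have "A * (2 * W + 3 + 1) \<le> A * (4 * A)" using W by (intro mult_left_mono) auto
  then have "bit_code p + 2 + A \<le> 4 * (A * A)"
    unfolding c by (simp add: distrib_left)
  with A have hi: "bit_code p + 1 < 2 ^ (2 * a + 2)"
    unfolding pow by linarith
  have "(2::nat) ^ (2 * a + 1) < 2 ^ Suc (length p)" "(2::nat) ^ length p < 2 ^ (2 * a + 2)"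
    using le_less_trans[OF lo bit_code_bounds(2)] le_less_trans[OF bit_code_bounds(1) hi]
    unfolding power_Suc by blast+
  then have "2 * a + 1 < Suc (length p)" "length p < 2 * a + 2"
    by (auto dest: power_less_imp_less_exp[rotated] simp del: power_Suc)
  then show ?thesis by linarith
qed

text \<open>Appending a string \<open>r\<close> adds 2^(2a+1) times its code, an even multiple of
  2^a. The power of two dividing \<open>bit_code p + 2\<close> exactly is unchanged, so a is the
  same for both strings, and a determines the length.\<close>

lemma self_delimiting_prefix:
  assumes "self_delimiting (bit_code p) a W" "self_delimiting (bit_code p') a' W'" "prefix p p'"
  shows "p = p'"
proof -
  obtain r where r: "p' = p @ r" using assms(3) by (auto simp: prefix_def)
  have "bit_code p' + 2 = 2 ^ a * (2 * W + 3) + 2 ^ (2 * a + 1) * bit_code r"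
    using assms(1) unfolding r bit_code_append length_self_delimiting[OF assms(1)]
      self_delimiting_def by linarith
  also have "\<dots> = 2 ^ a * (2 * (W + 1 + 2 ^ a * bit_code r) + 1)"
    by (simp only: distrib_left power_add mult_2 power_one_right)
  finally have "bit_code p' + 2 = 2 ^ a * (2 * (W + 1 + 2 ^ a * bit_code r) + 1)" .
  moreover have "bit_code p' + 2 = 2 ^ a' * (2 * (W' + 1) + 1)"
    using assms(2) by (simp add: self_delimiting_def distrib_left)
  ultimately have "2 ^ a * (2 * (W + 1 + 2 ^ a * bit_code r) + 1) = 2 ^ a' * (2 * (W' + 1) + 1)"
    by (rule trans[OF sym])
  from power2_mult_odd_unique[OF this] have "a = a'" ..
  then have "length p = length p'"
    unfolding length_self_delimiting[OF assms(1)] length_self_delimiting[OF assms(2)] by simp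
  with r show ?thesis by simp
qed

text \<open>A rule has at most \<open>k\<close> premises, so unrolling the map \<open>k\<close>
  times is enough. For fixed \<open>k\<close> this is a finite composition of computable functions,
  with no recursion over the list coded by \<open>J\<close>.\<close>

fun code_map :: "nat \<Rightarrow> nat \<Rightarrow> nat \<Rightarrow> nat" where
  "code_map 0 Q J = 0"
| "code_map (Suc k) Q J =
     (if J = 0 then 0 else Suc (prod_encode (code_nth Q (code_nth J 0), code_map k Q (code_tl J))))"

lemma code_map_list_encode:
  assumes "length js \<le> k" "\<And>j. j \<in> set js \<Longrightarrow> code_nth Q j = g j"
  shows "code_map k Q (list_encode js) = list_encode (map g js)"
  using assms
proof (induction js arbitrary: k)
  case Nil
  then show ?case by (cases k) simp_all
next
  case (Cons j js)
  then show ?case by (cases k) simp_all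
qed

lemma computable_code_map [computable_intros]:
  "computable a F \<Longrightarrow> computable a G \<Longrightarrow> computable a (\<lambda>xs. code_map k (F xs) (G xs))"
proof (induction k arbitrary: G)
  case 0
  show ?case by (simp, intro computable_intros)
next
  case (Suc k)
  show ?case unfolding code_map.simps by (intro computable_intros Suc)
qed

section \<open>Programs and their accepted runs\<close>

text \<open>
  A program codes \<open>\<langle>b, m, n, o, D\<rangle>\<close>: the \<open>j\<close>-th digit of \<open>D\<close> in base \<open>b\<close> is the \<open>j\<close>-th of \<open>n\<close>
  steps, coded as a pair of a rule and a list of indices; \<open>m\<close> is the size of the base, and \<open>o\<close> the
  output index. Digits keep the code short: under \<open>list_encode\<close> a list of length \<open>n\<close> may have a
  code with exponentially many bits in \<open>n\<close>.
\<close>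

definition prog_base :: "nat \<Rightarrow> nat" where "prog_base W = pfst W"
definition prog_m :: "nat \<Rightarrow> nat" where "prog_m W = pfst (psnd W)"
definition prog_n :: "nat \<Rightarrow> nat" where "prog_n W = pfst (psnd (psnd W))"
definition prog_out :: "nat \<Rightarrow> nat" where "prog_out W = pfst (psnd (psnd (psnd W)))"
definition prog_digits :: "nat \<Rightarrow> nat" where "prog_digits W = psnd (psnd (psnd (psnd W)))"

definition prog_step :: "nat \<Rightarrow> nat \<Rightarrow> nat" where
  "prog_step W j = prog_digits W div prog_base W ^ j mod prog_base W"

text \<open>The layout follows the set of inferences in \<open>effective_proof_system\<close>, so
  that a step is checked by a single membership query.\<close>

definition inference_code :: "nat \<Rightarrow> nat \<Rightarrow> nat \<Rightarrow> nat \<Rightarrow> nat" where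
  "inference_code k Q s c = list_encode [pfst s, code_map k Q (psnd s), c]"

text \<open>\<open>Q\<close> codes a pool obtained by running the program \<open>W\<close> on the base coded by \<open>L\<close>, where \<open>A\<close> is
  the set of codes of correct inferences.\<close>

definition is_run :: "nat set \<Rightarrow> nat \<Rightarrow> nat \<Rightarrow> nat \<Rightarrow> nat \<Rightarrow> bool" where
  "is_run A k L W Q \<longleftrightarrow>
     (\<forall>i<prog_m W. code_nth Q i = code_nth L i) \<and>
     (\<forall>j<prog_n W. inference_code k Q (prog_step W j) (code_nth Q (prog_m W + j)) \<in> A)"

lemmas prog_defs = prog_base_def prog_m_def prog_n_def prog_out_def prog_digits_def

lemma computable_is_run:
  assumes A: "decidable A" and "computable a F" "computable a G" "computable a H"
  shows "computable a (\<lambda>xs. of_bool (is_run A k (F xs) (G xs) (H xs)))"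
proof -
  have 1: "computable 2 (\<lambda>xs. of_bool (code_nth (pfst (xs ! 1)) (xs ! 0) = code_nth (psnd (xs ! 1)) (xs ! 0)))"
    by (intro computable_intros; simp)
  have "computable a (\<lambda>xs. of_bool (\<forall>i<prog_m (G xs).
      code_nth (pfst (prod_encode (H xs, F xs))) i = code_nth (psnd (prod_encode (H xs, F xs))) i))"
    by (rule computable_of_bool_all_less[OF 1])
      (unfold prog_defs, (intro computable_intros assms)+)
  moreover have 2: "computable 2 (\<lambda>xs. of_bool (inference_code k (psnd (xs ! 1)) (prog_step (pfst (xs ! 1)) (xs ! 0))
      (code_nth (psnd (xs ! 1)) (prog_m (pfst (xs ! 1)) + xs ! 0)) \<in> A))"
    unfolding inference_code_def prog_step_def prog_defs list_encode.simps
    by (intro decidable_imp_computable[OF A] computable_intros; simp)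
  have "computable a (\<lambda>xs. of_bool (\<forall>j<prog_n (G xs). inference_code k (psnd (prod_encode (G xs, H xs)))
      (prog_step (pfst (prod_encode (G xs, H xs))) j)
      (code_nth (psnd (prod_encode (G xs, H xs))) (prog_m (pfst (prod_encode (G xs, H xs))) + j)) \<in> A))"
    by (rule computable_of_bool_all_less[OF 2])
      (unfold prog_defs, (intro computable_intros assms)+)
  ultimately show ?thesis
    unfolding is_run_def by (intro computable_of_bool_conj) simp_all
qed

text \<open>The function searches for a number packing the length parameter \<open>a\<close>, the
  program \<open>W\<close> and a pool \<open>Q\<close> that pass a total test. Halting thus
  certifies the shape of the program whatever the input \<open>y\<close>, even though
  \<open>h\<close> may be partial. The second property asks all runs to agree on the output entry
  because the search need not return the given \<open>Q\<close>.\<close>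

lemma trace_program:
  assumes A: "decidable A"
  obtains f where
    "\<And>c y x. reval f [c, y] x \<Longrightarrow> \<exists>a W. self_delimiting c a W"
    "\<And>c y x a W L Q. reval h [y] L \<Longrightarrow> self_delimiting c a W \<Longrightarrow> is_run A k L W Q \<Longrightarrow>
       (\<And>Q. is_run A k L W Q \<Longrightarrow> code_nth Q (prog_out W) = x) \<Longrightarrow> reval f [c, y] x"
proof -
  define R where "R z c L \<longleftrightarrow> self_delimiting c (pfst z) (pfst (psnd z)) \<and>
    is_run A k L (pfst (psnd z)) (psnd (psnd z))" for z c L
  have "computable 3 (\<lambda>xs. 1 - of_bool (R (xs ! 0) (xs ! 1) (xs ! 2)))"
    unfolding R_def self_delimiting_def
    by (intro computable_intros computable_is_run[OF A]; simp)
  then obtain g where "\<And>xs. length xs = 3 \<Longrightarrow> reval g xs (1 - of_bool (R (xs ! 0) (xs ! 1) (xs ! 2)))"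
    by (auto simp: computable_def)
  from this[of "[_, _, _]"] have g: "reval g [z, c, L] (1 - of_bool (R z c L))" for z c L by simp
  have "computable 1 (\<lambda>xs. code_nth (psnd (psnd (xs ! 0))) (prog_out (pfst (psnd (xs ! 0)))))"
    unfolding prog_defs by (intro computable_intros; simp)
  then obtain e where "\<And>xs. length xs = 1 \<Longrightarrow>
      reval e xs (code_nth (psnd (psnd (xs ! 0))) (prog_out (pfst (psnd (xs ! 0)))))"
    by (auto simp: computable_def)
  from this[of "[_]"] have e: "reval e [z] (code_nth (psnd (psnd z)) (prog_out (pfst (psnd z))))" for z by simp
  define f where "f = Comp e [Comp (Mu g) [Proj 0, Comp h [Proj 1]]]"
  show thesis
  proof (rule that[of f])
    fix c y x assume "reval f [c, y] x"
    then obtain z L where "reval (Mu g) [c, L] z"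
      unfolding f_def
      by (auto elim!: reval_CompE reval_ProjE simp: list_all2_Cons1)
    then have "reval g [z, c, L] 0" by (blast elim: reval_MuE)
    from reval_functional[OF g this] have "R z c L" by (cases "R z c L") simp_all
    then show "\<exists>a W. self_delimiting c a W" unfolding R_def by blast
  next
    fix c y x a W L Q
    assume h: "reval h [y] L" and c: "self_delimiting c a W" and Q: "is_run A k L W Q"
      and out: "\<And>Q. is_run A k L W Q \<Longrightarrow> code_nth Q (prog_out W) = x"
    define z where "z = (LEAST z. R z c L)"
    have "R (prod_encode (a, prod_encode (W, Q))) c L"
      using c Q by (simp add: R_def)
    then have z: "R z c L" unfolding z_def by (rule LeastI)
    have least: "\<not> R i c L" if "i < z" for i
      using that unfolding z_def by (rule not_less_Least)
    have "reval (Mu g) [c, L] z"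
    proof (rule reval.intros)
      show "reval g [z, c, L] 0" using g[of z c L] z by simp
      show "\<forall>i<z. \<exists>y. reval g [i, c, L] (Suc y)"
      proof (intro allI impI)
        fix i assume "i < z"
        with g[of i c L] least[of i] have "reval g [i, c, L] (Suc 0)" by simp
        then show "\<exists>y. reval g [i, c, L] (Suc y)" ..
      qed
    qed
    moreover have "reval (Comp h [Proj 1]) [c, y] L"
      using h reval.intros(3)[of 1 "[c, y]"] by (intro reval.intros(4)[where ys = "[y]"]) auto
    ultimately have "reval (Comp (Mu g) [Proj 0, Comp h [Proj 1]]) [c, y] z"
      using reval.intros(3)[of 0 "[c, y]"] by (intro reval.intros(4)[where ys = "[c, L]"]) auto
    \<comment> \<open>The number found may contain another pool, but the program in it is determined
      by \<open>c\<close>; the output is then fixed by \<open>out\<close>.\<close>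
    moreover have "pfst (psnd z) = W"
      using z self_delimiting_unique[OF c] by (auto simp: R_def)
    then have "reval e [z] x"
      using e[of z] out[of "psnd (psnd z)"] z by (auto simp: R_def)
    ultimately show "reval f [c, y] x"
      unfolding f_def by (intro reval.intros(4)[where ys = "[z]"]) auto
  qed
qed

section \<open>Traces\<close>

lemma replay_append:
  "replay P pool (\<pi> @ \<pi>') = (case replay P pool \<pi> of None \<Rightarrow> None | Some pool' \<Rightarrow> replay P pool' \<pi>')"
  by (induction P pool \<pi> rule: replay.induct) (auto split: option.splits)

text \<open>Pools only grow, so premises and conclusion of each step can be read off the final pool.
  This turns a replay into a static condition, the kind that a search can test.\<close>

lemma replay_SomeD:
  assumes "replay P pool \<pi> = Some pool'"
  shows "length pool' = length pool + length \<pi>"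
    and "take (length pool) pool' = pool"
    and "j < length \<pi> \<Longrightarrow> fst (\<pi> ! j) \<in> rule_ids P \<and> (\<forall>t\<in>set (snd (\<pi> ! j)). t < length pool + j) \<and>
      conclusion P (fst (\<pi> ! j)) (map ((!) pool') (snd (\<pi> ! j))) = Some (pool' ! (length pool + j))"
proof -
  have "length pool' = length pool + length \<pi> \<and> take (length pool) pool' = pool \<and>
    (\<forall>j<length \<pi>. fst (\<pi> ! j) \<in> rule_ids P \<and> (\<forall>t\<in>set (snd (\<pi> ! j)). t < length pool + j) \<and>
      conclusion P (fst (\<pi> ! j)) (map ((!) pool') (snd (\<pi> ! j))) = Some (pool' ! (length pool + j)))"
    using assms
  proof (induction P pool \<pi> rule: replay.induct)
    case (2 P pool r js \<pi>)
    then obtain \<phi> where r: "r \<in> rule_ids P" "\<forall>j\<in>set js. j < length pool"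
      and \<phi>: "conclusion P r (map ((!) pool) js) = Some \<phi>" "replay P (pool @ [\<phi>]) \<pi> = Some pool'"
      by (auto split: if_splits option.splits)
    note IH = "2.IH"[OF conjI[OF r] \<phi>(1,2)]
    have len: "length pool' = length pool + length ((r, js) # \<pi>)" using IH by simp
    have take: "take (Suc (length pool)) pool' = pool @ [\<phi>]" using IH by simp
    have nth: "pool' ! t = (pool @ [\<phi>]) ! t" if "t \<le> length pool" for t
      using that take by (metis le_imp_less_Suc nth_take)
    have map: "map ((!) pool') js = map ((!) pool) js"
      using r(2) nth by (auto simp: nth_append)
    have "fst (((r, js) # \<pi>) ! j) \<in> rule_ids P \<and> (\<forall>t\<in>set (snd (((r, js) # \<pi>) ! j)). t < length pool + j) \<and>
      conclusion P (fst (((r, js) # \<pi>) ! j)) (map ((!) pool') (snd (((r, js) # \<pi>) ! j))) = Some (pool' ! (length pool + j))"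
      if "j < length ((r, js) # \<pi>)" for j
    proof (cases j)
      case 0
      then show ?thesis using r \<phi>(1) nth[of "length pool"] by (simp add: map del: map_eq_conv)
    next
      case (Suc i)
      then show ?thesis using IH that by simp
    qed
    moreover have "take (length pool) pool' = pool"
      using arg_cong[OF take, of "take (length pool)"] by (simp add: min_def)
    ultimately show ?case using len by blast
  qed simp
  then show "length pool' = length pool + length \<pi>" "take (length pool) pool' = pool"
    "j < length \<pi> \<Longrightarrow> fst (\<pi> ! j) \<in> rule_ids P \<and> (\<forall>t\<in>set (snd (\<pi> ! j)). t < length pool + j) \<and>
      conclusion P (fst (\<pi> ! j)) (map ((!) pool') (snd (\<pi> ! j))) = Some (pool' ! (length pool + j))"
    by blast+
qed

lemma replay_set_subset: "replay P pool \<pi> = Some pool' \<Longrightarrow> set pool \<subseteq> set pool'"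
  by (metis replay_SomeD(2) set_take_subset)

text \<open>The starting pool is arbitrary, so that the premises of a rule can be derived one after
  the other, each from the pool left by the previous ones.\<close>

lemma Cn_imp_replay:
  assumes "q \<in> Cn P B" "B \<subseteq> set pool"
  shows "\<exists>\<pi> pool'. replay P pool \<pi> = Some pool' \<and> q \<in> set pool'"
  using assms
proof (induction arbitrary: pool rule: Cn.induct)
  case (1 \<phi>)
  show ?case
  proof (intro exI)
    show "replay P pool [] = Some pool \<and> \<phi> \<in> set pool" using 1 by auto
  qed
next
  case (2 r ps \<phi>)
  have "\<exists>\<pi> pool'. replay P pool \<pi> = Some pool' \<and> set ps \<subseteq> set pool'"
    using "2.IH" \<open>B \<subseteq> set pool\<close>
  proof (induction ps arbitrary: pool)
    case Nil
    show ?case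
    proof (intro exI)
      show "replay P pool [] = Some pool \<and> set [] \<subseteq> set pool" by simp
    qed
  next
    case (Cons p ps)
    have "\<exists>\<pi> pool'. replay P pool \<pi> = Some pool' \<and> p \<in> set pool'"
      by (rule Cons.prems(1)[rule_format, THEN conjunct2, rule_format, OF _ Cons.prems(2)]) simp
    then obtain \<pi> pool1 where 1: "replay P pool \<pi> = Some pool1" "p \<in> set pool1" by blast
    have "B \<subseteq> set pool1" using Cons.prems(2) replay_set_subset[OF 1(1)] by simp
    moreover have "\<forall>x\<in>set ps. x \<in> Cn P B \<and>
        (\<forall>pool. B \<subseteq> set pool \<longrightarrow> (\<exists>\<pi> pool'. replay P pool \<pi> = Some pool' \<and> x \<in> set pool'))"
      using Cons.prems(1) by simp
    ultimately obtain \<pi>' pool2 where 2: "replay P pool1 \<pi>' = Some pool2" "set ps \<subseteq> set pool2"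
      using Cons.IH[of pool1] by blast
    show ?case
    proof (intro exI)
      show "replay P pool (\<pi> @ \<pi>') = Some pool2 \<and> set (p # ps) \<subseteq> set pool2"
        using 1 2 replay_set_subset[OF 2(1)] by (auto simp: replay_append)
    qed
  qed
  then obtain \<pi> pool' where \<pi>: "replay P pool \<pi> = Some pool'" "set ps \<subseteq> set pool'" by blast
  have "\<exists>js. map ((!) pool') js = ps \<and> (\<forall>j\<in>set js. j < length pool')"
    using \<pi>(2)
  proof (induction ps)
    case (Cons p ps)
    then obtain js where "map ((!) pool') js = ps" "\<forall>j\<in>set js. j < length pool'" by auto
    moreover obtain j where "j < length pool'" "pool' ! j = p" using Cons.prems by (auto simp: in_set_conv_nth)
    ultimately show ?case by (intro exI[of _ "j # js"]) auto
  qed simp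
  then obtain js where js: "map ((!) pool') js = ps" "\<forall>j\<in>set js. j < length pool'" by blast
  have "replay P pool (\<pi> @ [(r, js)]) = Some (pool' @ [\<phi>])"
    using js \<pi> 2(1,2) by (simp add: replay_append)
  moreover have "\<phi> \<in> set (pool' @ [\<phi>])" by simp
  ultimately show ?case by blast
qed

lemma min_trace_length_attained:
  assumes "q \<in> Cn P B" "B = set base" "base = ord B"
  obtains \<pi> pool i where "replay P base \<pi> = Some pool" "length \<pi> = min_trace_length P ord B q"
    "i < length pool" "pool ! i = q"
proof -
  obtain \<pi> pool where "replay P base \<pi> = Some pool" "q \<in> set pool"
    using Cn_imp_replay[OF assms(1), of base] assms(2) by auto
  then have "\<exists>tr. derives_by P base tr q \<and> length (fst tr) = length \<pi>"
    by (auto simp: derives_by_def in_set_conv_nth)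
  then have "\<exists>tr. derives_by P (ord B) tr q \<and> length (fst tr) = min_trace_length P ord B q"
    unfolding min_trace_length_def assms(3) by (rule LeastI)
  then show thesis using that unfolding derives_by_def assms(3) by blast
qed

section \<open>Runs of a program against replays of its trace\<close>

definition inference_codes :: "('f \<Rightarrow> bool list) \<Rightarrow> 'f proof_system \<Rightarrow> nat set" where
  "inference_codes enc P =
     {list_encode [r, list_encode (map (\<lambda>p. bit_code (enc p)) ps), bit_code (enc \<phi>)]
      | r ps \<phi>. r \<in> rule_ids P \<and> conclusion P r ps = Some \<phi>}"

text \<open>A run need not list premises before conclusions; here the genuine trace supplies this
  order. By induction along it, the base entries are forced, the premises of a step are already
  correct, and \<open>conclusion\<close> being a function leaves one possible result.\<close>

lemma is_run_replay:
  assumes sys: "effective_proof_system L enc k P" and replay: "replay P base \<pi> = Some pool"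
    and W: "prog_m W = length base" "prog_n W = length \<pi>"
      "\<And>j. j < length \<pi> \<Longrightarrow> prog_step W j = prod_encode (fst (\<pi> ! j), list_encode (snd (\<pi> ! j)))"
  defines "c \<equiv> \<lambda>s. bit_code (enc s)"
  shows "is_run (inference_codes enc P) k (list_encode (map c base)) W (list_encode (map c pool))"
    and "is_run (inference_codes enc P) k (list_encode (map c base)) W Q \<Longrightarrow>
      i < length pool \<Longrightarrow> code_nth Q i = c (pool ! i)"
proof -
  note D = replay_SomeD[OF replay]
  let ?r = "\<lambda>j. fst (\<pi> ! j)" and ?ps = "\<lambda>j. map ((!) pool) (snd (\<pi> ! j))"
  have concl: "?r j \<in> rule_ids P" "conclusion P (?r j) (?ps j) = Some (pool ! (length base + j))"
    "\<And>t. t \<in> set (snd (\<pi> ! j)) \<Longrightarrow> t < length base + j" "length (snd (\<pi> ! j)) \<le> k" "set (?ps j) \<subseteq> L"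
    if "j < length \<pi>" for j
  proof -
    show *: "?r j \<in> rule_ids P" "conclusion P (?r j) (?ps j) = Some (pool ! (length base + j))"
      "\<And>t. t \<in> set (snd (\<pi> ! j)) \<Longrightarrow> t < length base + j"
      using D(3)[OF that] by auto
    then have "length (?ps j) \<le> k \<and> set (?ps j) \<subseteq> L"
      using sys unfolding effective_proof_system_def by blast
    then show "length (snd (\<pi> ! j)) \<le> k" "set (?ps j) \<subseteq> L" by simp_all
  qed
  have base: "pool ! i = base ! i" if "i < length base" for i
    using D(2) that by (metis nth_take)
  have inf: "inference_code k Q (prog_step W j) (code_nth Q (length base + j)) =
      list_encode [?r j, list_encode (map c (?ps j)), code_nth Q (length base + j)]"
    if "j < length \<pi>" and Q: "\<And>i. i < length base + j \<Longrightarrow> code_nth Q i = c (pool ! i)" for Q j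
    using that(1) W(3) concl(3,4) Q
    by (simp add: inference_code_def code_map_list_encode[where g = "\<lambda>t. c (pool ! t)"] o_def)
  show "is_run (inference_codes enc P) k (list_encode (map c base)) W (list_encode (map c pool))"
    unfolding is_run_def W
  proof (intro conjI allI impI)
    fix i assume "i < length base"
    then show "code_nth (list_encode (map c pool)) i = code_nth (list_encode (map c base)) i"
      using base D(1) by simp
  next
    fix j assume j: "j < length \<pi>"
    have "list_encode [?r j, list_encode (map c (?ps j)), c (pool ! (length base + j))] \<in> inference_codes enc P"
      using concl(1,2)[OF j] unfolding inference_codes_def c_def mem_Collect_eq by blast
    moreover from j have "inference_code k (list_encode (map c pool)) (prog_step W j)
        (code_nth (list_encode (map c pool)) (length base + j)) =
      list_encode [?r j, list_encode (map c (?ps j)), c (pool ! (length base + j))]"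
      using D(1) by (subst inf) auto
    ultimately show "inference_code k (list_encode (map c pool)) (prog_step W j)
        (code_nth (list_encode (map c pool)) (length base + j)) \<in> inference_codes enc P"
      by (metis (no_types))
  qed
  assume Q: "is_run (inference_codes enc P) k (list_encode (map c base)) W Q"
  show "i < length pool \<Longrightarrow> code_nth Q i = c (pool ! i)"
  proof (induction i rule: less_induct)
    case (less i)
    show ?case
    proof (cases "i < length base")
      case True
      then have "code_nth Q i = code_nth (list_encode (map c base)) i"
        using Q W(1) by (simp add: is_run_def)
      then show ?thesis using base True by simp
    next
      case False
      then obtain j where j: "i = length base + j" "j < length \<pi>"
        using less.prems D(1) by (metis add_less_cancel_left le_add_diff_inverse not_less)
      have "inference_code k Q (prog_step W j) (code_nth Q i) \<in> inference_codes enc P"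
        using Q W(1,2) j by (simp add: is_run_def)
      then have "list_encode [?r j, list_encode (map c (?ps j)), code_nth Q i] \<in> inference_codes enc P"
        using inf[OF j(2), of Q] less j(1) D(1) j(2) by auto
      then obtain ps \<phi> where ps: "map c (?ps j) = map c ps" "code_nth Q i = c \<phi>"
        "conclusion P (?r j) ps = Some \<phi>"
        unfolding inference_codes_def c_def by (auto simp: list_encode_eq simp del: list_encode.simps)
      \<comment> \<open>The query only speaks of codes. Injectivity of \<open>enc\<close> on the
        language turns equal codes of premises into equal premises.\<close>
      have "set ps \<subseteq> L" "inj_on c L"
        using sys ps(3) concl(1)[OF j(2)]
        by (auto simp: effective_proof_system_def c_def inj_on_def bit_code_inject)
      with ps(1) concl(5)[OF j(2)] have "ps = ?ps j"
        by (metis Un_least inj_on_map_eq_map inj_on_subset)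
      with ps(3) concl(2)[OF j(2)] ps(2) j(1) show ?thesis by simp
    qed
  qed
qed

section \<open>Size of the program describing a trace\<close>

lemma exists_digits:
  fixes b :: nat
  assumes "\<forall>s\<in>set ss. s < b"
  shows "\<exists>D<b ^ length ss. \<forall>j<length ss. D div b ^ j mod b = ss ! j"
  using assms
proof (induction ss)
  case (Cons s ss)
  then obtain D where D: "D < b ^ length ss" "\<forall>j<length ss. D div b ^ j mod b = ss ! j" and s: "s < b"
    by auto
  have "s + b * D < b * Suc D" using s by simp
  also have "\<dots> \<le> b * b ^ length ss" using D(1) by (intro mult_left_mono) auto
  finally have "s + b * D < b ^ length (s # ss)" by simp
  moreover have "(s + b * D) div b ^ j mod b = (s # ss) ! j" if "j < length (s # ss)" for j
  proof (cases j)
    case (Suc i)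
    have "(s + b * D) div b ^ j = (s + b * D) div b div b ^ i"
      unfolding Suc by (simp add: div_mult2_eq)
    also have "(s + b * D) div b = D" using s by simp
    finally show ?thesis using D(2) that Suc by simp
  qed (use s in simp)
  ultimately show ?case by blast
qed simp

text \<open>Pairing is quadratic, which doubles the exponent, and the constants are absorbed by the
  extra factor x^4 as x \<ge> 2. Sizes are kept as powers of x because the logarithm makes the
  exponent a factor of log x.\<close>

lemma prod_encode_le_power:
  assumes "2 \<le> x" "u \<le> x ^ i" "v \<le> x ^ j"
  shows "prod_encode (u, v) \<le> x ^ (2 * (i + j) + 4)"
proof -
  have tri: "triangle s \<le> s * s" for s by (induction s) auto
  have "triangle (u + v) + u \<le> triangle (Suc (u + v))" by simp
  also have "\<dots> \<le> Suc (u + v) * Suc (u + v)" by (rule tri)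
  finally have *: "prod_encode (u, v) \<le> Suc (u + v) * Suc (u + v)" by (simp add: prod_encode_def)
  have "u \<le> x ^ (i + j)" "v \<le> x ^ (i + j)" "1 \<le> x ^ (i + j)"
    using assms order_trans[OF assms(2) power_increasing[of i "i + j" x]]
      order_trans[OF assms(3) power_increasing[of j "i + j" x]] by auto
  then have "Suc (u + v) \<le> 4 * x ^ (i + j)" by linarith
  also have "\<dots> \<le> x ^ 2 * x ^ (i + j)"
    using power_mono[OF assms(1), of 2] by (intro mult_right_mono) auto
  finally have "Suc (u + v) * Suc (u + v) \<le> (x ^ 2 * x ^ (i + j)) * (x ^ 2 * x ^ (i + j))"
    by (intro mult_mono) auto
  also have "\<dots> = x ^ (2 * (i + j) + 4)" by (simp only: power_add[symmetric]) (rule arg_cong[of _ _ "power x"], simp)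
  finally show ?thesis using * by simp
qed

text \<open>For bounded length the nested pairing is still polynomial in the entries, with an
  exponent depending on \<open>k\<close> alone.\<close>

lemma list_encode_le_power:
  "\<exists>e. \<forall>js x. 2 \<le> x \<and> length js \<le> k \<and> (\<forall>j\<in>set js. j \<le> x) \<longrightarrow> list_encode js \<le> x ^ e"
proof (induction k)
  case 0
  show ?case by simp
next
  case (Suc k)
  then obtain e where e: "\<And>js x. 2 \<le> x \<Longrightarrow> length js \<le> k \<Longrightarrow> \<forall>j\<in>set js. j \<le> x \<Longrightarrow> list_encode js \<le> x ^ e"
    by blast
  have "list_encode js \<le> x ^ (2 * (1 + e) + 5)"
    if x: "2 \<le> x" and js: "length js \<le> Suc k" "\<forall>j\<in>set js. j \<le> x" for js x
  proof (cases js)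
    case (Cons j js')
    have "prod_encode (j, list_encode js') \<le> x ^ (2 * (1 + e) + 4)"
      using js Cons by (intro prod_encode_le_power x e) auto
    also have "\<dots> < x ^ (2 * (1 + e) + 5)" using x by (intro power_strict_increasing) auto
    finally show ?thesis using Cons by simp
  qed simp
  then show ?case by blast
qed

text \<open>A power of x with fixed exponent is thus a valid digit base for all steps; finitely many
  rule identifiers are bounded by a constant c, and c \<le> 2^c \<le> x^c.\<close>

lemma step_code_less_power:
  assumes "finite R"
  obtains e where "\<And>r js x. r \<in> R \<Longrightarrow> 2 \<le> x \<Longrightarrow> length js \<le> k \<Longrightarrow> \<forall>j\<in>set js. j \<le> x \<Longrightarrow>
    prod_encode (r, list_encode js) < x ^ e"
proof -
  obtain c where c: "\<And>r. r \<in> R \<Longrightarrow> r \<le> c"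
    using assms by (auto simp: finite_nat_set_iff_bounded_le)
  obtain e where e: "\<And>js x. 2 \<le> x \<Longrightarrow> length js \<le> k \<Longrightarrow> \<forall>j\<in>set js. j \<le> x \<Longrightarrow> list_encode js \<le> x ^ e"
    using list_encode_le_power[of k] by blast
  show thesis
  proof (rule that)
    fix r js and x :: nat
    assume *: "r \<in> R" "2 \<le> x" "length js \<le> k" "\<forall>j\<in>set js. j \<le> x"
    have "r \<le> 2 ^ c" using c[OF *(1)] less_exp[of c] by linarith
    also have "\<dots> \<le> x ^ c" using *(2) by (rule power_mono) simp
    finally have "prod_encode (r, list_encode js) \<le> x ^ (2 * (c + e) + 4)"
      using * e by (intro prod_encode_le_power) auto
    also have "\<dots> < x ^ (2 * (c + e) + 5)" using *(2) by (intro power_strict_increasing) auto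
    finally show "prod_encode (r, list_encode js) < x ^ (2 * (c + e) + 5)" .
  qed
qed

lemma exists_self_delimiting:
  obtains p a where "self_delimiting (bit_code p) a W" "real (length p) \<le> 2 * log 2 (real (W + 1)) + 1"
proof -
  obtain a where a: "2 ^ a \<le> W + 1" "W + 1 < 2 ^ (a + 1)"
    using ex_power_ivl1[of 2 "W + 1"] by auto
  obtain p where "bit_code p = 2 ^ a * (2 * W + 3) - 2" using bit_code_surj by blast
  \<comment> \<open>This makes the truncated subtraction of 2 exact.\<close>
  moreover have "1 * 2 \<le> 2 ^ a * (2 * W + 3)" by (intro mult_mono) auto
  ultimately have p: "self_delimiting (bit_code p) a W"
    using a by (simp add: self_delimiting_def)
  have "2 powr real a \<le> real (W + 1)"
    using a(1) by (metis of_nat_le_iff of_nat_numeral of_nat_power powr_realpow zero_less_numeral)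
  then have "real a \<le> log 2 (real (W + 1))" by (subst le_log_iff) auto
  then show thesis using that[OF p] length_self_delimiting[OF p] by simp
qed

lemma cond_K_le_trace_length:
  assumes univ: "universal_machine U"
    and sys: "effective_proof_system L enc k P"
    and canon: "canonical_encoding enc S ord encB"
  obtains C :: real where "\<And>B q. premise_base S B \<Longrightarrow> q \<in> Cn P B \<Longrightarrow> 2 \<le> card B \<Longrightarrow>
    1 \<le> min_trace_length P ord B q \<Longrightarrow>
    real (cond_K U (enc q) (encB B)) \<le>
      C * real (min_trace_length P ord B q) * log 2 (real (card B + min_trace_length P ord B q))"
proof -
  let ?A = "inference_codes enc P" and ?c = "\<lambda>s. bit_code (enc s)"
  obtain h where h: "\<And>B. premise_base S B \<Longrightarrow>
      reval h [bit_code (encB B)] (list_encode (map ?c (ord B)))"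
    using canon unfolding canonical_encoding_def by blast
  have ord: "distinct (ord B)" "set (ord B) = B" if "premise_base S B" for B
    using canon that unfolding canonical_encoding_def by blast+
  have A: "decidable ?A"
    using sys unfolding effective_proof_system_def inference_codes_def by blast
  obtain f where f1: "\<And>c y x. reval f [c, y] x \<Longrightarrow> \<exists>a W. self_delimiting c a W"
    and f2: "\<And>c y x a W L Q. reval h [y] L \<Longrightarrow> self_delimiting c a W \<Longrightarrow> is_run ?A k L W Q \<Longrightarrow>
       (\<And>Q. is_run ?A k L W Q \<Longrightarrow> code_nth Q (prog_out W) = x) \<Longrightarrow> reval f [c, y] x"
    using trace_program[OF A, where h = h and k = k] by metis
  \<comment> \<open>The description is definite because \<open>reval\<close> is functional and
    \<open>bit_code\<close> is injective.\<close>
  define V :: machine where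
    "V p y = (if \<exists>x. reval f [bit_code p, bit_code y] (bit_code x)
              then Some (THE x. reval f [bit_code p, bit_code y] (bit_code x)) else None)" for p y
  have V: "V p y = Some x \<longleftrightarrow> reval f [bit_code p, bit_code y] (bit_code x)" for p y x
  proof -
    have "(THE x. reval f [bit_code p, bit_code y] (bit_code x)) = x"
      if "reval f [bit_code p, bit_code y] (bit_code x)" for x
      using that by (rule the_equality) (metis reval_functional that bit_code_inject)
    then show ?thesis unfolding V_def by auto
  qed
  have "partial_computable V" unfolding partial_computable_def using V by blast
  moreover have "prefix_free_machine V"
    unfolding prefix_free_machine_def
  proof (intro allI impI)
    fix y p p' assume *: "V p y \<noteq> None \<and> V p' y \<noteq> None \<and> prefix p p'"
    then obtain x x' where "V p y = Some x" "V p' y = Some x'" by blast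
    then obtain a W a' W' where "self_delimiting (bit_code p) a W" "self_delimiting (bit_code p') a' W'"
      unfolding V using f1 by meson
    then show "p = p'" using * self_delimiting_prefix by blast
  qed
  ultimately obtain w where w: "\<And>p y. U (w @ p) y = V p y"
    using univ unfolding universal_machine_def by blast
  have "finite (rule_ids P)" using sys unfolding effective_proof_system_def by blast
  then obtain g where g: "\<And>r js x. r \<in> rule_ids P \<Longrightarrow> 2 \<le> x \<Longrightarrow> length js \<le> k \<Longrightarrow> \<forall>j\<in>set js. j \<le> x \<Longrightarrow>
      prod_encode (r, list_encode js) < x ^ g"
    using step_code_less_power[of "rule_ids P" k] by blast
  \<comment> \<open>The prefix \<open>w\<close> selects the machine inside \<open>U\<close>, the
    self-delimiting form costs twice the bits of \<open>W\<close> plus 1, and 18g + 89 bounds the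
    logarithm of \<open>W + 1\<close> in units of n log x. Everything is fixed before the base and
    the formula.\<close>
  define C where "C = real (length w) + 1 + 2 * (18 * real g + 89)"
  show thesis
  proof (rule that[of C])
    fix B q
    assume B: "premise_base S B" and q: "q \<in> Cn P B" and m2: "2 \<le> card B"
      and n1: "1 \<le> min_trace_length P ord B q"
    define m where "m = card B"
    define n where "n = min_trace_length P ord B q"
    define x where "x = m + n"
    have x: "2 \<le> x" using m2 by (simp add: x_def m_def)
    have len: "length (ord B) = m" using ord[OF B] distinct_card[of "ord B"] by (simp add: m_def)
    obtain \<pi> pool i where \<pi>: "replay P (ord B) \<pi> = Some pool" "length \<pi> = n" and i: "i < length pool" "pool ! i = q"
      using min_trace_length_attained[OF q] ord(2)[OF B] unfolding n_def by metis
    note D = replay_SomeD[OF \<pi>(1)]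
    define ss where "ss = map (\<lambda>(r, js). prod_encode (r, list_encode js)) \<pi>"
    have length_ss: "length ss = length \<pi>" by (simp add: ss_def)
    have ss: "ss ! j = prod_encode (fst (\<pi> ! j), list_encode (snd (\<pi> ! j)))" "ss ! j < x ^ g"
      if j: "j < length \<pi>" for j
    proof -
      show *: "ss ! j = prod_encode (fst (\<pi> ! j), list_encode (snd (\<pi> ! j)))"
        using j by (simp add: ss_def case_prod_beta)
      have "length (map ((!) pool) (snd (\<pi> ! j))) \<le> k"
        using D(3)[OF j] sys unfolding effective_proof_system_def by blast
      then show "ss ! j < x ^ g"
        unfolding * using D(3)[OF j] j \<pi>(2) len by (intro g x) (auto simp: x_def intro: less_imp_le less_trans)
    qed
    have "\<forall>s\<in>set ss. s < x ^ g" using ss(2) by (auto simp: in_set_conv_nth length_ss)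
    from exists_digits[OF this] obtain D' where D': "D' < (x ^ g) ^ n"
      "\<And>j. j < n \<Longrightarrow> D' div (x ^ g) ^ j mod (x ^ g) = ss ! j"
      using \<pi>(2) length_ss by auto
    define W where "W = prod_encode (x ^ g, prod_encode (m, prod_encode (n, prod_encode (i, D'))))"
    have W: "prog_m W = length (ord B)" "prog_n W = length \<pi>" "prog_out W = i"
      "\<And>j. j < length \<pi> \<Longrightarrow> prog_step W j = prod_encode (fst (\<pi> ! j), list_encode (snd (\<pi> ! j)))"
      using D'(2) ss(1) \<pi>(2) len by (simp_all add: W_def prog_defs prog_step_def)
    obtain p a where p: "self_delimiting (bit_code p) a W" "real (length p) \<le> 2 * log 2 (real (W + 1)) + 1"
      by (rule exists_self_delimiting)
    note run = is_run_replay[OF sys \<pi>(1) W(1,2,4)]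
    have "reval f [bit_code p, bit_code (encB B)] (bit_code (enc q))"
      by (rule f2[OF h[OF B] p(1) run(1)]) (use run(2) i W(3) in auto)
    then have "U (w @ p) (encB B) = Some (enc q)" unfolding w V .
    then have "cond_K U (enc q) (encB B) \<le> length (w @ p)"
      unfolding cond_K_def by (intro Least_le) blast
    moreover have "log 2 (real (W + 1)) \<le> (18 * real g + 89) * (real n * log 2 (real x))"
    proof -
      have "D' \<le> x ^ (g * n)" using D'(1) by (simp add: power_mult)
      moreover have le: "i \<le> x ^ 1" "n \<le> x ^ 1" "m \<le> x ^ 1"
        using i D(1) len \<pi>(2) by (simp_all add: x_def)
      \<comment> \<open>Each of the four pairings doubles the exponent and adds to it, whence 16 =
        2^4 in front of g n. A further 1 in the exponent absorbs the 1 in \<open>W + 1\<close>, and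
        n \<ge> 1 turns 16gn + 2g + 89 into (18g + 89)n.\<close>
      ultimately have "W \<le> x ^ (2 * (g + (2 * (1 + (2 * (1 + (2 * (1 + g * n) + 4)) + 4)) + 4)) + 4)"
        unfolding W_def by (intro prod_encode_le_power[OF x] order.refl)
      also have "\<dots> = x ^ (16 * (g * n) + 2 * g + 88)" by (rule arg_cong[of _ _ "power x"]) simp
      also have "\<dots> < x ^ (16 * (g * n) + 2 * g + 89)" using x by (intro power_strict_increasing) auto
      finally have "W + 1 \<le> x ^ (16 * (g * n) + 2 * g + 89)" by simp
      then have "real (W + 1) \<le> real x ^ (16 * (g * n) + 2 * g + 89)"
        unfolding of_nat_power[symmetric] of_nat_le_iff .
      then have "log 2 (real (W + 1)) \<le> log 2 (real x ^ (16 * (g * n) + 2 * g + 89))"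
        by (intro log_mono) auto
      also have "\<dots> = real (16 * (g * n) + 2 * g + 89) * log 2 (real x)"
        using x by (simp add: log_nat_power)
      also have "\<dots> \<le> real ((18 * g + 89) * n) * log 2 (real x)"
      proof (intro mult_right_mono)
        have "g \<le> g * n" "1 \<le> n" using n1 by (simp_all add: n_def)
        then show "real (16 * (g * n) + 2 * g + 89) \<le> real ((18 * g + 89) * n)"
          unfolding of_nat_le_iff distrib_right by linarith
      qed (use x in simp)
      finally show ?thesis by (simp add: algebra_simps)
    qed
    moreover have "1 \<le> real n * log 2 (real x)"
    proof -
      have "1 * 1 \<le> real n * log 2 (real x)"
        using n1 x by (intro mult_mono) (auto simp: n_def le_log_iff)
      then show ?thesis by simp
    qed
    then have "(real (length w) + 1) * 1 \<le> (real (length w) + 1) * (real n * log 2 (real x))"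
      by (intro mult_left_mono) auto
    ultimately have "real (cond_K U (enc q) (encB B)) \<le> C * (real n * log 2 (real x))"
      using p(2) by (simp add: C_def algebra_simps)
    then show "real (cond_K U (enc q) (encB B)) \<le>
      C * real (min_trace_length P ord B q) * log 2 (real (card B + min_trace_length P ord B q))"
      by (simp add: x_def m_def n_def mult.assoc)
  qed
qed

section \<open>Asymptotics\<close>

text \<open>A constant factor inside the logarithm becomes one outside, since log y \<ge> 1. This
  exchanges m + n for m + d.\<close>

lemma log_le_mult_log:
  fixes c x y :: real
  assumes "1 \<le> c" "1 \<le> x" "2 \<le> y" "x \<le> c * y"
  shows "log 2 x \<le> (1 + log 2 c) * log 2 y"
proof -
  have y: "1 \<le> log 2 y" and c: "0 \<le> log 2 c" using assms by (simp_all add: le_log_iff)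
  have "log 2 x \<le> log 2 (c * y)" using assms by (intro log_mono) auto
  also have "\<dots> = log 2 c * 1 + log 2 y" using assms by (simp add: log_mult)
  also have "\<dots> \<le> log 2 c * log 2 y + log 2 y" using y c by (intro add_right_mono mult_left_mono) auto
  finally show ?thesis by (simp add: algebra_simps)
qed

text \<open>The two bounds are given in terms of n; since n and d differ by constant factors, both
  the factor and the logarithm can be rewritten in d. The lower constant is positive because
  \<delta> < 1.\<close>

lemma complexity_bigtheta:
  fixes m d n K :: "'i \<Rightarrow> nat" and C cmin cmax \<delta> :: real
  assumes m: "\<forall>\<^sub>F i in F. 2 \<le> m i" and d: "\<And>i. 1 \<le> d i"
    and c: "0 < cmin" "0 < cmax" and \<delta>: "\<delta> < 1"
    and n: "\<And>i. cmin * real (d i) \<le> real (n i)" "\<And>i. real (n i) \<le> cmax * real (d i)"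
    and lower: "\<And>i. (1 - \<delta>) * real (n i) * log 2 (real (m i + n i)) \<le> real (K i)"
    and upper: "\<And>i. 2 \<le> m i \<Longrightarrow> 1 \<le> n i \<Longrightarrow> real (K i) \<le> C * real (n i) * log 2 (real (m i + n i))"
  shows "(\<lambda>i. real (K i)) \<in> \<Theta>[F](\<lambda>i. real (d i) * log 2 (real (m i + d i)))"
proof (rule bigthetaI)
  have n1: "1 \<le> n i" for i
  proof -
    have "0 < cmin * real (d i)" using c d[of i] by simp
    with n(1)[of i] show ?thesis by linarith
  qed
  \<comment> \<open>The maximum with 1 lets the same constant also cover the summand
    \<open>m i\<close>.\<close>
  define a where "a = max 1 (1 / cmin)"
  define b where "b = max 1 cmax"
  have ab: "1 \<le> a" "1 \<le> b" by (simp_all add: a_def b_def)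
  have "real (d i) \<le> a * real (n i)" for i
  proof -
    have "real (d i) \<le> (1 / cmin) * real (n i)" using n(1)[of i] c by (simp add: field_simps)
    also have "\<dots> \<le> a * real (n i)" by (intro mult_right_mono) (auto simp: a_def)
    finally show ?thesis .
  qed
  then have da: "real (m i + d i) \<le> a * real (m i + n i)" for i
    using mult_right_mono[OF ab(1), of "real (m i)"] by (simp add: distrib_left add_mono)
  have "real (n i) \<le> b * real (d i)" for i
  proof -
    have "cmax * real (d i) \<le> b * real (d i)" by (intro mult_right_mono) (auto simp: b_def)
    with n(2)[of i] show ?thesis by linarith
  qed
  then have nb: "real (m i + n i) \<le> b * real (m i + d i)" for i
    using mult_right_mono[OF ab(2), of "real (m i)"] by (simp add: distrib_left add_mono)
  have log_d: "log 2 (real (m i + d i)) \<le> (1 + log 2 a) * log 2 (real (m i + n i))"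
    and log_n: "log 2 (real (m i + n i)) \<le> (1 + log 2 b) * log 2 (real (m i + d i))"
    and log_pos: "0 \<le> log 2 (real (m i + d i))" "0 \<le> log 2 (real (m i + n i))" if "2 \<le> m i" for i
    using that da[of i] nb[of i] ab by (auto intro!: log_le_mult_log)
  have log_ab: "0 < 1 + log 2 a" "0 < 1 + log 2 b" using ab by (simp_all add: add_pos_nonneg)
  show "(\<lambda>i. real (K i)) \<in> O[F](\<lambda>i. real (d i) * log 2 (real (m i + d i)))"
  proof (rule bigoI[where c = "\<bar>C\<bar> * cmax * (1 + log 2 b)"], use m in eventually_elim)
    fix i assume m: "2 \<le> m i"
    have "real (K i) \<le> \<bar>C\<bar> * (real (n i) * log 2 (real (m i + n i)))"
    proof -
      have "C * (real (n i) * log 2 (real (m i + n i))) \<le> \<bar>C\<bar> * (real (n i) * log 2 (real (m i + n i)))"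
        using log_pos(2)[OF m] by (intro mult_right_mono) auto
      with upper[OF m n1] show ?thesis by (simp add: mult.assoc)
    qed
    also have "\<dots> \<le> \<bar>C\<bar> * ((cmax * real (d i)) * ((1 + log 2 b) * log 2 (real (m i + d i))))"
      using n(2)[of i] log_n[OF m] log_pos[OF m] c by (intro mult_left_mono mult_mono) auto
    finally show "norm (real (K i)) \<le> \<bar>C\<bar> * cmax * (1 + log 2 b) * norm (real (d i) * log 2 (real (m i + d i)))"
      using log_pos(1)[OF m] by (simp add: mult_ac)
  qed
  show "(\<lambda>i. real (K i)) \<in> \<Omega>[F](\<lambda>i. real (d i) * log 2 (real (m i + d i)))"
  proof (rule landau_omega.bigI[where c = "(1 - \<delta>) * cmin / (1 + log 2 a)"])
    show "0 < (1 - \<delta>) * cmin / (1 + log 2 a)" using \<delta> c log_ab by simp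
    show "\<forall>\<^sub>F i in F. (1 - \<delta>) * cmin / (1 + log 2 a) * norm (real (d i) * log 2 (real (m i + d i))) \<le> norm (real (K i))"
      using m
    proof eventually_elim
      fix i assume m: "2 \<le> m i"
      have "log 2 (real (m i + d i)) / (1 + log 2 a) \<le> log 2 (real (m i + n i))"
        using log_d[OF m] log_ab by (simp add: field_simps)
      then have "(1 - \<delta>) * ((cmin * real (d i)) * (log 2 (real (m i + d i)) / (1 + log 2 a)))
          \<le> (1 - \<delta>) * (real (n i) * log 2 (real (m i + n i)))"
        using n(1)[of i] log_pos[OF m] log_ab \<delta> c by (intro mult_left_mono mult_mono) auto
      also have "\<dots> \<le> real (K i)" using lower[of i] by (simp add: mult.assoc)
      finally show "(1 - \<delta>) * cmin / (1 + log 2 a) * norm (real (d i) * log 2 (real (m i + d i))) \<le> norm (real (K i))"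
        using log_pos(1)[OF m] by (simp add: mult_ac)
    qed
  qed
qed

lemma bigtheta_add_smallo:
  assumes "f \<in> \<Theta>[F](g)" "h \<in> o[F](g)"
  shows "(\<lambda>i. f i + h i) \<in> \<Theta>[F](g)"
proof -
  have "h \<in> o[F](f)" using assms by (simp add: landau_o.small.cong_bigtheta)
  then have "(\<lambda>i. f i + h i) \<in> \<Theta>[F](f)"
    using landau_theta.plus_absorb2[of h F f] bigtheta_refl[of "\<lambda>i. f i + h i" F] by simp
  then show ?thesis using assms(1) by (rule landau_theta.trans)
qed

section \<open>Comparison of caching with derivation\<close>

lemma cost_cache_eq:
  "0 < d \<Longrightarrow> cost_cache \<rho> l d c f = d * (1 + \<rho> * l / d) / f + c"
  by (simp add: cost_cache_def distrib_left add_divide_distrib)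

text \<open>Eventually each of the two summands is at most half of d.\<close>

lemma cache_cheaper:
  fixes d c f f\<^sub>c :: "'i \<Rightarrow> real"
  assumes "c \<in> o[F](d)" "f\<^sub>c \<in> o[F](f)" "\<And>i. 0 < d i" "\<And>i. 0 < f i"
  shows "\<forall>\<^sub>F i in F. d i * f\<^sub>c i / f i + c i \<le> d i"
proof -
  have half: "0 < 1 / (2::real)" by simp
  show ?thesis
    using landau_o.smallD[OF assms(1) half] landau_o.smallD[OF assms(2) half]
  proof eventually_elim
    case (elim i)
    have "d i * f\<^sub>c i \<le> d i * (1 / 2 * f i)"
      using elim(2) assms(3)[of i] assms(4)[of i] by (intro mult_left_mono) auto
    then have "d i * f\<^sub>c i / f i \<le> d i / 2" using assms(4)[of i] by (simp add: field_simps)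
    moreover have "c i \<le> d i / 2" using elim(1) assms(3)[of i] by simp
    ultimately show ?case by linarith
  qed
qed

lemma derive_cheaper:
  fixes d c f f\<^sub>c :: "'i \<Rightarrow> real"
  assumes "c \<in> o[F](d)" "f \<in> o[F](f\<^sub>c)" "\<And>i. 0 < d i" "\<And>i. 0 < f i" "\<And>i. 0 < f\<^sub>c i"
  shows "\<forall>\<^sub>F i in F. d i \<le> d i * f\<^sub>c i / f i + c i"
proof -
  have half: "0 < 1 / (2::real)" by simp
  show ?thesis
    using landau_o.smallD[OF assms(1) half] landau_o.smallD[OF assms(2) half]
  proof eventually_elim
    case (elim i)
    have "d i * (2 * f i) \<le> d i * f\<^sub>c i"
      using elim(2) assms(3)[of i] assms(4)[of i] assms(5)[of i] by (intro mult_left_mono) auto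
    then have "2 * d i \<le> d i * f\<^sub>c i / f i" using assms(4)[of i] by (simp add: field_simps)
    \<comment> \<open>\<open>c\<close> is controlled in absolute value and may be negative; the main
      term is at least 2d, which leaves room for it.\<close>
    moreover have "- (d i / 2) \<le> c i" using elim(1) assms(3)[of i] by (simp add: abs_le_iff)
    ultimately show ?case using assms(3)[of i] by linarith
  qed
qed

lemma cache_comparable:
  fixes d c f f\<^sub>c :: "'i \<Rightarrow> real"
  assumes c: "c \<in> o[F](d)" and f: "f \<in> \<Theta>[F](f\<^sub>c)" and f_pos: "\<And>i. 0 < f i"
  shows "(\<lambda>i. d i * f\<^sub>c i / f i + c i) \<in> \<Theta>[F](d)"
proof -
  have "(\<lambda>i. d i * f\<^sub>c i / f i) \<in> \<Theta>[F](\<lambda>i. d i * f i / f i)"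
    using f by (intro landau_theta.mult landau_theta.divide bigtheta_refl) (auto simp: bigtheta_sym f_pos less_imp_neq[OF f_pos, symmetric])
  then have "(\<lambda>i. d i * f\<^sub>c i / f i) \<in> \<Theta>[F](d)"
    by (simp add: less_imp_neq[OF f_pos, symmetric])
  from this c show ?thesis by (rule bigtheta_add_smallo)
qed

text \<open>From \<open>f\<^sub>c \<in> o[F](f)\<close> the cached cost d \<open>f\<^sub>c\<close> /
  f + \<open>c_hit\<close> is only known to be small against d: for f equal to
  \<open>f\<^sub>c\<close> times the square root of d it tends to infinity. Hence optimality comes
  with the bound O(1 + d \<open>f\<^sub>c\<close> / f), and O(1) is claimed once d
  \<open>f\<^sub>c\<close> is O(f).\<close>

theorem mainTheorem6:
  fixes \<Sigma> :: vocabulary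
    and enc :: "fm \<Rightarrow> bool list"
    and P :: "fm proof_system"
    and k :: nat
    and S :: "fm set"
    and ord :: "fm set \<Rightarrow> fm list"
    and encB :: "fm set \<Rightarrow> bool list"
    and PO :: "fm \<Rightarrow> fm set"
    and nf :: "fm \<Rightarrow> nat \<times> fm list"
    and U :: machine
    and cw :: "fm set \<Rightarrow> fm \<Rightarrow> bool list"
    and bnd :: "real poly"
    and \<C> :: "(fm \<times> fm set) set"
    and F :: "'i filter"
    and q :: "'i \<Rightarrow> fm"
    and B\<^sub>0 :: "'i \<Rightarrow> fm set"
    and m d n K l :: "'i \<Rightarrow> nat"
    and c_hit :: "'i \<Rightarrow> real"
    and \<rho> \<delta> \<delta>\<^sub>0 :: real
  assumes vocab: "wf_vocabulary \<Sigma>"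
    and sys: "effective_proof_system (fo_lfp \<Sigma>) enc k P"
    and amb: "ambient_set (fo_lfp \<Sigma>) enc S"
    and canon: "canonical_encoding enc S ord encB"
    and pred: "predecessor_map enc S PO"
    and univ: "universal_machine U"
    and code: "cache_code U P enc S encB cw"
    and considered: "\<C> \<subseteq> {(q, B). q \<in> S \<and> premise_base S B}"
    and in_class: "\<And>i. (q i, B\<^sub>0 i) \<in> \<C>"
    and align: "\<And>q B. (q, B) \<in> \<C> \<Longrightarrow> aligned P S PO nf B"
    and ser: "serializable P ord S PO \<C>"
    and q_derivable: "\<And>i. q i \<in> Cn P (B\<^sub>0 i)"
    and m_eq: "\<And>i. m i = card (B\<^sub>0 i)"
    and d_eq: "\<And>i. d i = Dd S PO (B\<^sub>0 i) (q i)"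
    and n_eq: "\<And>i. n i = min_trace_length P ord (B\<^sub>0 i) (q i)"
    and K_eq: "\<And>i. K i = cond_K U (enc (q i)) (encB (B\<^sub>0 i))"
    and l_eq: "\<And>i. l i = length (cw (B\<^sub>0 i) (q i))"
    and m_lim: "filterlim m at_top F"
    and d_ge_1: "\<And>i. d i \<ge> 1"
    and d_lower: "\<And>i. log 2 (real (m i)) \<le> real (d i)"
    and d_upper: "\<And>i. real (d i) \<le> poly bnd (real (m i))"
    and info_rich: "(\<lambda>i. real (K i)) \<in> \<omega>[F](\<lambda>i. log 2 (real (m i)))"
    and richness: "rich P enc ord S bnd \<delta>\<^sub>0"
    and deltas: "0 < \<delta>\<^sub>0" "\<delta>\<^sub>0 < \<delta>" "\<delta> < 1"
    and generic: "\<And>i. real (K i) \<ge> (1 - \<delta>) * real (n i) * log 2 (real (m i + n i))"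
    and price: "\<rho> > 0"
    and hit: "c_hit \<in> O[F](\<lambda>_. 1)"
  shows
    "(\<forall>f :: 'i \<Rightarrow> real. (\<forall>i. f i \<ge> 1) \<longrightarrow>
       (\<exists>g\<^sub>1 g\<^sub>2 g\<^sub>3 :: 'i \<Rightarrow> real.
          g\<^sub>1 \<in> O[F](\<lambda>i. real (d i) / f i) \<and>
          g\<^sub>2 \<in> O[F](\<lambda>_. 1) \<and>
          g\<^sub>3 \<in> \<Theta>[F](\<lambda>i. real (K i) / log 2 (real (m i + d i))) \<and>
          (\<forall>i. cost_cache \<rho> (l i) (d i) (c_hit i) (f i) = \<rho> * real (K i) / f i + g\<^sub>1 i + g\<^sub>2 i) \<and>
          (\<forall>i. cost_deriv (d i) = g\<^sub>3 i) \<and>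
          (\<forall>i. cost_opt \<rho> (l i) (d i) (c_hit i) (f i)
                = min (\<rho> * real (K i) / f i + g\<^sub>1 i + g\<^sub>2 i) (g\<^sub>3 i)))) \<and>
     (\<exists>f\<^sub>c :: 'i \<Rightarrow> real.
        (\<forall>i. f\<^sub>c i \<ge> 1) \<and>
        f\<^sub>c \<in> \<Theta>[F](\<lambda>i. \<rho> * log 2 (real (m i + d i))) \<and>
        (\<lambda>i. cost_cache \<rho> (l i) (d i) (c_hit i) (f\<^sub>c i)) \<sim>[F] (\<lambda>i. cost_deriv (d i)) \<and>
        (\<forall>f :: 'i \<Rightarrow> real. (\<forall>i. f i \<ge> 1) \<longrightarrow>
           (f\<^sub>c \<in> o[F](f) \<longrightarrow>
              (\<forall>\<^sub>F i in F. cost_opt \<rho> (l i) (d i) (c_hit i) (f i)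
                            = cost_cache \<rho> (l i) (d i) (c_hit i) (f i)) \<and>
              (\<lambda>i. cost_opt \<rho> (l i) (d i) (c_hit i) (f i))
                \<in> O[F](\<lambda>i. 1 + real (d i) * f\<^sub>c i / f i) \<and>
              ((\<lambda>i. real (d i) * f\<^sub>c i) \<in> O[F](f) \<longrightarrow>
                 (\<lambda>i. cost_opt \<rho> (l i) (d i) (c_hit i) (f i)) \<in> O[F](\<lambda>_. 1))) \<and>
           (f \<in> o[F](f\<^sub>c) \<longrightarrow>
              (\<forall>\<^sub>F i in F. cost_opt \<rho> (l i) (d i) (c_hit i) (f i) = cost_deriv (d i) \<and>
                           cost_opt \<rho> (l i) (d i) (c_hit i) (f i)
                             = real (Dd S PO (B\<^sub>0 i) (q i)))) \<and>
           (f \<in> \<Theta>[F](f\<^sub>c) \<longrightarrow>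
              (\<lambda>i. cost_cache \<rho> (l i) (d i) (c_hit i) (f i)) \<in> \<Theta>[F](\<lambda>i. cost_deriv (d i)))))"
proof -
  let ?D = "\<lambda>i. real (d i)" and ?lg = "\<lambda>i. log 2 (real (m i + d i))"
  let ?cache = "\<lambda>f i. cost_cache \<rho> (l i) (d i) (c_hit i) (f i)"
  let ?opt = "\<lambda>f i. cost_opt \<rho> (l i) (d i) (c_hit i) (f i)"
  have base: "premise_base S (B\<^sub>0 i)" for i using considered in_class[of i] by auto
  have D_pos: "0 < ?D i" for i using d_ge_1[of i] by simp
  obtain cmin cmax where c: "0 < cmin" "0 < cmax"
    and n_bounds: "\<And>i. cmin * ?D i \<le> real (n i)" "\<And>i. real (n i) \<le> cmax * ?D i"
  proof -
    obtain cmin cmax where c: "0 < cmin" "0 < cmax"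
      and *: "\<forall>(q, B)\<in>\<C>. q \<in> Cn P B \<longrightarrow>
          cmin * real (Dd S PO B q) \<le> real (min_trace_length P ord B q) \<and>
          real (min_trace_length P ord B q) \<le> cmax * real (Dd S PO B q)"
      using ser unfolding serializable_def by blast
    have "cmin * ?D i \<le> real (n i)" "real (n i) \<le> cmax * ?D i" for i
      using bspec[OF * in_class[of i]] q_derivable[of i] unfolding d_eq n_eq by auto
    with c show thesis by (rule that)
  qed
  obtain C where C: "real (K i) \<le> C * real (n i) * log 2 (real (m i + n i))" if "2 \<le> m i" "1 \<le> n i" for i
    using cond_K_le_trace_length[OF univ sys canon] base q_derivable unfolding K_eq n_eq m_eq by metis
  have "\<forall>\<^sub>F i in F. 2 \<le> m i" using m_lim by (simp add: filterlim_at_top)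
  then have K_theta: "(\<lambda>i. real (K i)) \<in> \<Theta>[F](\<lambda>i. ?D i * ?lg i)"
    by (rule complexity_bigtheta[OF _ d_ge_1 c deltas(3) n_bounds generic C])
  obtain Cl where l: "\<And>i. K i \<le> l i" "\<And>i. l i \<le> K i + Cl"
    using code base q_derivable unfolding cache_code_def K_eq l_eq by meson

  have log_m: "filterlim (\<lambda>i. log 2 (real (m i))) at_top F"
    unfolding filterlim_at_top
  proof
    fix Z :: real
    have "\<forall>\<^sub>F i in F. 2 ^ nat \<lceil>Z\<rceil> \<le> m i" using m_lim by (simp add: filterlim_at_top)
    then show "\<forall>\<^sub>F i in F. Z \<le> log 2 (real (m i))"
    proof eventually_elim
      case (elim i)
      then have "real (nat \<lceil>Z\<rceil>) \<le> log 2 (real (m i))" by (intro le_log2_of_power) simp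
      then show ?case using real_nat_ceiling_ge[of Z] by linarith
    qed
  qed
  \<comment> \<open>Both d, by its lower bound, and log(m+d) dominate log m and hence every
    constant.\<close>
  have small: "(\<lambda>_. 1 :: real) \<in> o[F](g)" if "\<forall>\<^sub>F i in F. log 2 (real (m i)) \<le> g i" for g
  proof -
    have "filterlim g at_infinity F"
      using filterlim_at_top_mono[OF log_m that] by (rule filterlim_at_top_imp_at_infinity)
    then show ?thesis by (simp add: smallomega_iff_smallo[symmetric] smallomega_1_conv_filterlim)
  qed
  have D_small: "(\<lambda>_. 1) \<in> o[F](?D)" using d_lower by (intro small) simp
  have "\<forall>\<^sub>F i in F. 1 \<le> m i" using m_lim by (simp add: filterlim_at_top)
  then have "\<forall>\<^sub>F i in F. log 2 (real (m i)) \<le> ?lg i" by eventually_elim (auto intro: log_mono)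
  then have lg_small: "(\<lambda>_. 1) \<in> o[F](?lg)" by (rule small)
  \<comment> \<open>Only eventually: the logarithm vanishes when m + d = 1.\<close>
  have lg_ev: "\<forall>\<^sub>F i in F. ?lg i \<noteq> 0"
    using \<open>\<forall>\<^sub>F i in F. 2 \<le> m i\<close>
  proof eventually_elim
    case (elim i)
    then have "0 < ?lg i" by simp
    then show ?case by linarith
  qed
  have hit_small: "c_hit \<in> o[F](?D)" using hit D_small by (rule landau_o.big_small_trans)

  have overhead: "(\<lambda>i. real (l i) - real (K i)) \<in> O[F](\<lambda>_. 1)"
  proof (intro bigoI always_eventually allI)
    fix i
    have "real (K i) \<le> real (l i)" "real (l i) \<le> real (K i + Cl)" using l by (simp_all only: of_nat_le_iff)
    then show "norm (real (l i) - real (K i)) \<le> real Cl * norm (1 :: real)" by simp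
  qed
  have "(\<lambda>i. 1 * 1 :: real) \<in> o[F](\<lambda>i. ?D i * ?lg i)"
    by (rule landau_o.small_mult[OF D_small lg_small])
  then have "(\<lambda>i. real (l i) - real (K i)) \<in> o[F](\<lambda>i. ?D i * ?lg i)"
    using landau_o.big_small_trans[OF overhead] by simp
  from bigtheta_add_smallo[OF K_theta this]
  have l_theta: "(\<lambda>i. real (l i)) \<in> \<Theta>[F](\<lambda>i. ?D i * ?lg i)" by simp

  \<comment> \<open>Up to \<open>c_hit\<close>, this is the frequency at which the cached cost
    equals d. The summand 1 accounts for the single derivation made before storing, and makes
    \<open>f\<^sub>c\<close> an admissible frequency.\<close>
  define f\<^sub>c where "f\<^sub>c i = 1 + \<rho> * real (l i) / ?D i" for i
  have fc_ge: "1 \<le> f\<^sub>c i" for i using price by (simp add: f\<^sub>c_def)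
  have cache_eq: "?cache f i = ?D i * f\<^sub>c i / f i + c_hit i" for f i
    unfolding f\<^sub>c_def by (rule cost_cache_eq[OF D_pos])
  have derive_eq: "cost_deriv (d i) = ?D i" for i by (simp add: cost_deriv_def)
  have opt_eq: "?opt f i = min (?cache f i) (?D i)" for f i by (simp add: cost_opt_def derive_eq)

  have "(\<lambda>i. \<rho> * real (l i) / ?D i) \<in> \<Theta>[F](\<lambda>i. \<rho> * (?D i * ?lg i) / ?D i)"
    using l_theta D_pos by (intro landau_theta.divide landau_theta.mult bigtheta_refl) (auto simp: less_imp_neq[symmetric])
  also have "(\<lambda>i. \<rho> * (?D i * ?lg i) / ?D i) = (\<lambda>i. \<rho> * ?lg i)"
  proof
    show "\<rho> * (?D i * ?lg i) / ?D i = \<rho> * ?lg i" for i using D_pos[of i] by simp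
  qed
  finally have "(\<lambda>i. \<rho> * real (l i) / ?D i) \<in> \<Theta>[F](\<lambda>i. \<rho> * ?lg i)" .
  moreover have "(\<lambda>_. 1) \<in> o[F](\<lambda>i. \<rho> * ?lg i)"
    using lg_small price by simp
  ultimately have "(\<lambda>i. \<rho> * real (l i) / ?D i + 1) \<in> \<Theta>[F](\<lambda>i. \<rho> * ?lg i)"
    by (rule bigtheta_add_smallo)
  then have fc_theta: "f\<^sub>c \<in> \<Theta>[F](\<lambda>i. \<rho> * ?lg i)"
    unfolding f\<^sub>c_def[abs_def] by (simp add: add.commute)

  have "\<exists>g\<^sub>1 g\<^sub>2 g\<^sub>3 :: 'i \<Rightarrow> real.
      g\<^sub>1 \<in> O[F](\<lambda>i. ?D i / f i) \<and> g\<^sub>2 \<in> O[F](\<lambda>_. 1) \<and> g\<^sub>3 \<in> \<Theta>[F](\<lambda>i. real (K i) / ?lg i) \<and>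
      (\<forall>i. ?cache f i = \<rho> * real (K i) / f i + g\<^sub>1 i + g\<^sub>2 i) \<and>
      (\<forall>i. cost_deriv (d i) = g\<^sub>3 i) \<and>
      (\<forall>i. ?opt f i = min (\<rho> * real (K i) / f i + g\<^sub>1 i + g\<^sub>2 i) (g\<^sub>3 i))"
    if f: "\<forall>i. 1 \<le> f i" for f
  proof (intro exI conjI allI)
    \<comment> \<open>The bounded part collects the overhead of the cache code over K and
      \<open>c_hit\<close>; dividing the overhead by f keeps it bounded as f \<ge> 1. The other
      witnesses are d / f and d itself.\<close>
    let ?g\<^sub>2 = "\<lambda>i. \<rho> * (real (l i) - real (K i)) / f i + c_hit i"
    show "(\<lambda>i. ?D i / f i) \<in> O[F](\<lambda>i. ?D i / f i)" by simp
    have "(\<lambda>i. 1 / f i) \<in> O[F](\<lambda>_. 1)"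
    proof (intro bigoI[where c = 1] always_eventually allI)
      fix i
      have "1 \<le> f i" using f by blast
      then show "norm (1 / f i) \<le> 1 * norm (1 :: real)" by simp
    qed
    from landau_o.big_mult[OF overhead this]
    have "(\<lambda>i. (real (l i) - real (K i)) / f i) \<in> O[F](\<lambda>_. 1)" by simp
    then have "(\<lambda>i. \<rho> * ((real (l i) - real (K i)) / f i)) \<in> O[F](\<lambda>_. 1)"
      using price by (subst landau_o.big.cmult_in_iff) auto
    then have "(\<lambda>i. \<rho> * (real (l i) - real (K i)) / f i) \<in> O[F](\<lambda>_. 1)"
      by (simp only: times_divide_eq_right)
    then show "?g\<^sub>2 \<in> O[F](\<lambda>_. 1)" using hit by (rule sum_in_bigo)
    have "(\<lambda>i. real (K i) / ?lg i) \<in> \<Theta>[F](\<lambda>i. ?D i * ?lg i / ?lg i)"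
      using K_theta lg_ev by (intro landau_theta.divide bigtheta_refl) auto
    also have "(\<lambda>i. ?D i * ?lg i / ?lg i) \<in> \<Theta>[F](?D)"
      using lg_ev by (intro bigthetaI_cong) (auto elim: eventually_mono)
    finally show "?D \<in> \<Theta>[F](\<lambda>i. real (K i) / ?lg i)" by (simp add: bigtheta_sym)
    show *: "?cache f i = \<rho> * real (K i) / f i + ?D i / f i + ?g\<^sub>2 i" for i
      by (simp add: cost_cache_def right_diff_distrib diff_divide_distrib)
    show "cost_deriv (d i) = ?D i" for i by (rule derive_eq)
    show "?opt f i = min (\<rho> * real (K i) / f i + ?D i / f i + ?g\<^sub>2 i) (?D i)" for i
      unfolding opt_eq * ..
  qed
  moreover have "?cache f\<^sub>c \<sim>[F] (\<lambda>i. cost_deriv (d i))"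
  proof -
    \<comment> \<open>The costs at \<open>f\<^sub>c\<close> differ by \<open>c_hit\<close>, which is
      o(d), so their equality is asymptotic equivalence and not only equality of order.\<close>
    have "?cache f\<^sub>c = (\<lambda>i. ?D i + c_hit i)"
    proof
      fix i
      show "?cache f\<^sub>c i = ?D i + c_hit i" unfolding cache_eq using fc_ge[of i] by simp
    qed
    then show ?thesis using asymp_equiv_add_right[OF hit_small] by (simp add: derive_eq)
  qed
  moreover have "(f\<^sub>c \<in> o[F](f) \<longrightarrow>
        (\<forall>\<^sub>F i in F. ?opt f i = ?cache f i) \<and>
        ?opt f \<in> O[F](\<lambda>i. 1 + ?D i * f\<^sub>c i / f i) \<and>
        ((\<lambda>i. ?D i * f\<^sub>c i) \<in> O[F](f) \<longrightarrow> ?opt f \<in> O[F](\<lambda>_. 1))) \<and>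
      (f \<in> o[F](f\<^sub>c) \<longrightarrow>
        (\<forall>\<^sub>F i in F. ?opt f i = cost_deriv (d i) \<and> ?opt f i = real (Dd S PO (B\<^sub>0 i) (q i)))) \<and>
      (f \<in> \<Theta>[F](f\<^sub>c) \<longrightarrow> ?cache f \<in> \<Theta>[F](\<lambda>i. cost_deriv (d i)))"
    if f: "\<forall>i. 1 \<le> f i" for f
  proof (intro conjI impI)
    have f_pos: "0 < f i" for i using f by (metis less_le_trans zero_less_one)
    have fc_pos: "0 < f\<^sub>c i" for i using fc_ge by (metis less_le_trans zero_less_one)
    have term_nonneg: "0 \<le> ?D i * f\<^sub>c i / f i" for i
      using f_pos[of i] fc_pos[of i] by simp
    {
      assume fc_small: "f\<^sub>c \<in> o[F](f)"
      show ev: "\<forall>\<^sub>F i in F. ?opt f i = ?cache f i"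
        using cache_cheaper[OF hit_small fc_small D_pos f_pos]
        unfolding opt_eq cache_eq by eventually_elim simp
      have "c_hit \<in> O[F](\<lambda>i. 1 + ?D i * f\<^sub>c i / f i)"
        using hit
      proof (rule landau_o.big_trans)
        show "(\<lambda>_. 1) \<in> O[F](\<lambda>i. 1 + ?D i * f\<^sub>c i / f i)"
          using term_nonneg by (intro bigoI[where c = 1] always_eventually allI) simp
      qed
      moreover have "(\<lambda>i. ?D i * f\<^sub>c i / f i) \<in> O[F](\<lambda>i. 1 + ?D i * f\<^sub>c i / f i)"
      proof (intro bigoI[where c = 1] always_eventually allI)
        have "norm x \<le> 1 * norm (1 + x)" if "0 \<le> x" for x :: real using that by simp
        from this[OF term_nonneg] show "norm (?D i * f\<^sub>c i / f i) \<le> 1 * norm (1 + ?D i * f\<^sub>c i / f i)" for i .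
      qed
      ultimately have "?cache f \<in> O[F](\<lambda>i. 1 + ?D i * f\<^sub>c i / f i)"
        unfolding cache_eq by (rule sum_in_bigo(1)[rotated])
      then show opt_O: "?opt f \<in> O[F](\<lambda>i. 1 + ?D i * f\<^sub>c i / f i)"
        using landau_o.big.in_cong[OF ev] by simp
      assume "(\<lambda>i. ?D i * f\<^sub>c i) \<in> O[F](f)"
      then have "(\<lambda>i. ?D i * f\<^sub>c i / f i) \<in> O[F](\<lambda>i. f i / f i)"
        using f_pos by (intro landau_o.big.divide_right) (auto simp: less_imp_neq[symmetric])
      then have "(\<lambda>i. 1 + ?D i * f\<^sub>c i / f i) \<in> O[F](\<lambda>_. 1)"
        using less_imp_neq[OF f_pos, symmetric] by (intro sum_in_bigo) simp_all
      with opt_O show "?opt f \<in> O[F](\<lambda>_. 1)" by (rule landau_o.big_trans)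
    }
    assume "f \<in> o[F](f\<^sub>c)"
    from derive_cheaper[OF hit_small this D_pos f_pos fc_pos]
    show "\<forall>\<^sub>F i in F. ?opt f i = cost_deriv (d i) \<and> ?opt f i = real (Dd S PO (B\<^sub>0 i) (q i))"
      unfolding d_eq[symmetric] opt_eq cache_eq derive_eq by eventually_elim simp
  next
    assume "f \<in> \<Theta>[F](f\<^sub>c)"
    then show "?cache f \<in> \<Theta>[F](\<lambda>i. cost_deriv (d i))"
      unfolding cache_eq derive_eq using f by (intro cache_comparable hit_small) (auto intro: less_le_trans[OF zero_less_one])
  qed
  ultimately show ?thesis using fc_ge fc_theta by blast
qed

end
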